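(* Let $R\subseteq\mathsf{BiPlan}$ be the graphical subcollection spanned, for every connected graph $\Gamma$ on three vertices and every ordering $(v_1,v_2,v_3)$ of $V_\Gamma$ with $\{v_1,v_2\},\{v_2,v_3\}\in E_\Gamma$, by $((v_1v_2)v_3)-(v_1(v_2v_3))$. Then the morphism of contractads $\mathsf{BiPlan}\to\mathsf{PlanEq}$ sending each tree to its left-to-right sequence of leaves (so $\nu\mapsto(1,2)$) is surjective with kernel the contractad ideal $\langle R\rangle$; that is, $\mathsf{PlanEq}$ is generated by $\mu=(1,2)$ and $\mu^{(12)}=(2,1)$ subject to these relations.
   Context: Graphs are finite, simple, undirected. A tube of $\Gamma$ is a nonempty $G\subseteq V_\Gamma$ with $\Gamma|_G$ connected; $\Gamma/G$ contracts $G$ to one vertex $\{G\}$. $\mathsf{P}_n$ is the path on $\{1,\dots,n\}$. A contractad over a field $\mathsf{k}$: vector spaces $\mathcal{P}(\Gamma)$ for nonempty connected graphs, functorial in isomorphisms, with unit in $\mathcal{P}(\mathsf{P}_1)$ and equivariant, unital, associative infinitesimal compositions $\circ^\Gamma_G:\mathcal{P}(\Gamma/G)\otimes\mathcal{P}(\Gamma|_G)\to\mathcal{P}(\Gamma)$ for tubes $G$. The contractad ideal generated by $R$ is the smallest subcollection containing $R$ stable under isomorphisms and under compositions with arbitrary elements in either slot. A $\Gamma$-admissible planar binary tree is a planar rooted tree, each internal vertex with two children, leaves labelled bijectively by $V_\Gamma$, such that the leaf labels below each vertex form a tube. $\mathsf{BiPlan}(\Gamma)$ is the vector space with basis these trees,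 with composition by grafting at the leaf $\{G\}$; it is the free contractad on $\nu$ (tree with leaves $1,2$) and $\nu^{(12)}$ (leaves $2,1$). $((v_1v_2)v_3)$ is the tree with a cherry $v_1,v_2$ as left child of the root and leaf $v_3$ as right child; $(v_1(v_2v_3))$ has leaf $v_1$ on the left and cherry $v_2,v_3$ on the right. $\mathsf{PlanEq}(\Gamma)$ is the vector space with basis the orderings $(v_1,\dots,v_n)$ of $V_\Gamma$ that arise as the left-to-right leaf sequence of some $\Gamma$-admissible planar binary tree. Its contractad structure is substitution: $(u_1,\dots,u_{k-1},\{G\},u_{k+1},\dots)\circ^\Gamma_G(w_1,\dots,w_m)=(u_1,\dots,u_{k-1},w_1,\dots,w_m,u_{k+1},\dots)$ (which corresponds to grafting of trees). *)

theory Defs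
  imports Complex_Main "HOL-Library.Poly_Mapping" "HOL-Library.Infinite_Typeclass"
begin

section \<open>Graphs, tubes, contraction\<close>

record 'v graph =
  verts :: "'v set"
  edges :: "'v set set"

definition simple_graph :: "'v graph \<Rightarrow> bool" where
  "simple_graph \<Gamma> \<longleftrightarrow> finite (verts \<Gamma>) \<and>
     edges \<Gamma> \<subseteq> {{u, v} | u v. u \<in> verts \<Gamma> \<and> v \<in> verts \<Gamma> \<and> u \<noteq> v}"

definition connected_graph :: "'v graph \<Rightarrow> bool" where
  "connected_graph \<Gamma> \<longleftrightarrow> simple_graph \<Gamma> \<and> verts \<Gamma> \<noteq> {} \<and>
     (\<forall>u \<in> verts \<Gamma>. \<forall>v \<in> verts \<Gamma>. (u, v) \<in> {(x, y). {x, y} \<in> edges \<Gamma>}\<^sup>*)"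

definition induced :: "'v graph \<Rightarrow> 'v set \<Rightarrow> 'v graph" where
  "induced \<Gamma> G = \<lparr>verts = G, edges = {e \<in> edges \<Gamma>. e \<subseteq> G}\<rparr>"

definition tube :: "'v graph \<Rightarrow> 'v set \<Rightarrow> bool" where
  "tube \<Gamma> G \<longleftrightarrow> G \<noteq> {} \<and> G \<subseteq> verts \<Gamma> \<and> connected_graph (induced \<Gamma> G)"

definition map_graph :: "('v \<Rightarrow> 'v) \<Rightarrow> 'v graph \<Rightarrow> 'v graph" where
  "map_graph f \<Gamma> = \<lparr>verts = f ` verts \<Gamma>, edges = (`) f ` edges \<Gamma>\<rparr>"

text \<open>
  In \<open>contract \<Gamma> G s\<close> the vertex set \<open>G\<close> is contracted to a single vertex whose name
  \<open>s\<close> (written \<open>{G}\<close> in the literature) is a parameter; it may be any element outside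
  \<open>verts \<Gamma> - G\<close>, which is what \<open>tube_name \<Gamma> G s\<close> demands. All statements below quantify over
  all such names, so that graphs and their contractions share one vertex type.
\<close>

definition contract :: "'v graph \<Rightarrow> 'v set \<Rightarrow> 'v \<Rightarrow> 'v graph" where
  "contract \<Gamma> G s =
     (let q = (\<lambda>v. if v \<in> G then s else v)
      in \<lparr>verts = insert s (verts \<Gamma> - G), edges = {q ` e | e. e \<in> edges \<Gamma> \<and> \<not> e \<subseteq> G}\<rparr>)"

definition tube_name :: "'v graph \<Rightarrow> 'v set \<Rightarrow> 'v \<Rightarrow> bool" where
  "tube_name \<Gamma> G s \<longleftrightarrow> tube \<Gamma> G \<and> s \<notin> verts \<Gamma> - G"

definition path_graph :: "'v list \<Rightarrow> 'v graph" where
  "path_graph vs = \<lparr>verts = set vs, edges = {{vs ! i, vs ! Suc i} | i. Suc i < length vs}\<rparr>"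

section \<open>Contractads\<close>

text \<open>
  The spaces \<open>carr P \<Gamma>\<close> are subspaces of one ambient vector space with scalar multiplication
  \<open>scl P\<close>. The map \<open>act P \<Gamma> f\<close> is the action of the isomorphism
  \<open>f : \<Gamma> \<rightarrow> map_graph f \<Gamma>\<close>, for \<open>f\<close> injective on the vertices.
  The unit is given on every one-vertex graph, compatibly with relabelling, which amounts to
  a single element on \<open>P\<^sub>1\<close>. The operation \<open>icomp P \<Gamma> G s\<close> is the infinitesimal composition
  \<open>P(\<Gamma>/G) \<otimes> P(\<Gamma>|G) \<rightarrow> P(\<Gamma>)\<close>, as a bilinear map, with the contracted vertex named \<open>s\<close>.
\<close>

record ('k, 'v, 'x) contractad_data =
  scl :: "'k \<Rightarrow> 'x \<Rightarrow> 'x"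
  carr :: "'v graph \<Rightarrow> 'x set"
  act :: "'v graph \<Rightarrow> ('v \<Rightarrow> 'v) \<Rightarrow> 'x \<Rightarrow> 'x"
  cunit :: "'v \<Rightarrow> 'x"
  icomp :: "'v graph \<Rightarrow> 'v set \<Rightarrow> 'v \<Rightarrow> 'x \<Rightarrow> 'x \<Rightarrow> 'x"

locale contractad =
  fixes P :: "('k::field, 'v, 'x::ab_group_add) contractad_data"
  assumes vector_space: "vector_space (scl P)"
    and subspace_carr: "connected_graph \<Gamma> \<Longrightarrow> module.subspace (scl P) (carr P \<Gamma>)"
    and act_closed:
      "\<lbrakk>connected_graph \<Gamma>; inj_on f (verts \<Gamma>); x \<in> carr P \<Gamma>\<rbrakk>
         \<Longrightarrow> act P \<Gamma> f x \<in> carr P (map_graph f \<Gamma>)"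
    and act_add:
      "\<lbrakk>connected_graph \<Gamma>; inj_on f (verts \<Gamma>); x \<in> carr P \<Gamma>; y \<in> carr P \<Gamma>\<rbrakk>
         \<Longrightarrow> act P \<Gamma> f (x + y) = act P \<Gamma> f x + act P \<Gamma> f y"
    and act_scale:
      "\<lbrakk>connected_graph \<Gamma>; inj_on f (verts \<Gamma>); x \<in> carr P \<Gamma>\<rbrakk>
         \<Longrightarrow> act P \<Gamma> f (scl P c x) = scl P c (act P \<Gamma> f x)"
    and act_cong:
      "\<lbrakk>connected_graph \<Gamma>; inj_on f (verts \<Gamma>); \<And>v. v \<in> verts \<Gamma> \<Longrightarrow> f v = g v; x \<in> carr P \<Gamma>\<rbrakk>
         \<Longrightarrow> act P \<Gamma> f x = act P \<Gamma> g x"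
    and act_id: "\<lbrakk>connected_graph \<Gamma>; x \<in> carr P \<Gamma>\<rbrakk> \<Longrightarrow> act P \<Gamma> id x = x"
    and act_comp:
      "\<lbrakk>connected_graph \<Gamma>; inj_on f (verts \<Gamma>); inj_on g (f ` verts \<Gamma>); x \<in> carr P \<Gamma>\<rbrakk>
         \<Longrightarrow> act P (map_graph f \<Gamma>) g (act P \<Gamma> f x) = act P \<Gamma> (g \<circ> f) x"
    and unit_closed: "cunit P v \<in> carr P (path_graph [v])"
    and unit_act: "act P (path_graph [v]) f (cunit P v) = cunit P (f v)"
    and icomp_closed:
      "\<lbrakk>connected_graph \<Gamma>; tube_name \<Gamma> G s; x \<in> carr P (contract \<Gamma> G s); y \<in> carr P (induced \<Gamma> G)\<rbrakk>
         \<Longrightarrow> icomp P \<Gamma> G s x y \<in> carr P \<Gamma>"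
    and icomp_add_left:
      "\<lbrakk>connected_graph \<Gamma>; tube_name \<Gamma> G s; x \<in> carr P (contract \<Gamma> G s);
        x' \<in> carr P (contract \<Gamma> G s); y \<in> carr P (induced \<Gamma> G)\<rbrakk>
         \<Longrightarrow> icomp P \<Gamma> G s (x + x') y = icomp P \<Gamma> G s x y + icomp P \<Gamma> G s x' y"
    and icomp_add_right:
      "\<lbrakk>connected_graph \<Gamma>; tube_name \<Gamma> G s; x \<in> carr P (contract \<Gamma> G s);
        y \<in> carr P (induced \<Gamma> G); y' \<in> carr P (induced \<Gamma> G)\<rbrakk>
         \<Longrightarrow> icomp P \<Gamma> G s x (y + y') = icomp P \<Gamma> G s x y + icomp P \<Gamma> G s x y'"
    and icomp_scale_left:
      "\<lbrakk>connected_graph \<Gamma>; tube_name \<Gamma> G s; x \<in> carr P (contract \<Gamma> G s); y \<in> carr P (induced \<Gamma> G)\<rbrakk>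
         \<Longrightarrow> icomp P \<Gamma> G s (scl P c x) y = scl P c (icomp P \<Gamma> G s x y)"
    and icomp_scale_right:
      "\<lbrakk>connected_graph \<Gamma>; tube_name \<Gamma> G s; x \<in> carr P (contract \<Gamma> G s); y \<in> carr P (induced \<Gamma> G)\<rbrakk>
         \<Longrightarrow> icomp P \<Gamma> G s x (scl P c y) = scl P c (icomp P \<Gamma> G s x y)"
    \<comment> \<open>equivariance, including independence of the name of the contracted vertex\<close>
    and icomp_act:
      "\<lbrakk>connected_graph \<Gamma>; tube_name \<Gamma> G s; inj_on f (verts \<Gamma>); t \<notin> f ` (verts \<Gamma> - G);
        x \<in> carr P (contract \<Gamma> G s); y \<in> carr P (induced \<Gamma> G)\<rbrakk>
         \<Longrightarrow> act P \<Gamma> f (icomp P \<Gamma> G s x y) =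
             icomp P (map_graph f \<Gamma>) (f ` G) t
               (act P (contract \<Gamma> G s) (f(s := t)) x) (act P (induced \<Gamma> G) f y)"
    and icomp_unit_left:
      "\<lbrakk>connected_graph \<Gamma>; x \<in> carr P \<Gamma>\<rbrakk> \<Longrightarrow> icomp P \<Gamma> (verts \<Gamma>) s (cunit P s) x = x"
    and icomp_unit_right:
      "\<lbrakk>connected_graph \<Gamma>; v \<in> verts \<Gamma>; tube_name \<Gamma> {v} s; x \<in> carr P (contract \<Gamma> {v} s)\<rbrakk>
         \<Longrightarrow> icomp P \<Gamma> {v} s x (cunit P v) = act P (contract \<Gamma> {v} s) (id(s := v)) x"
    and icomp_assoc_nested:
      "\<lbrakk>connected_graph \<Gamma>; tube_name \<Gamma> G s; tube_name \<Gamma> H t; G \<subseteq> H;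
        x \<in> carr P (contract \<Gamma> H t); y \<in> carr P (contract (induced \<Gamma> H) G s);
        z \<in> carr P (induced \<Gamma> G)\<rbrakk>
         \<Longrightarrow> icomp P \<Gamma> H t x (icomp P (induced \<Gamma> H) G s y z) =
             icomp P \<Gamma> G s (icomp P (contract \<Gamma> G s) (insert s (H - G)) t x y) z"
    and icomp_assoc_disjoint:
      "\<lbrakk>connected_graph \<Gamma>; tube_name \<Gamma> G s; tube_name \<Gamma> H t; G \<inter> H = {}; s \<noteq> t;
        x \<in> carr P (contract (contract \<Gamma> G s) H t);
        y \<in> carr P (induced \<Gamma> G); z \<in> carr P (induced \<Gamma> H)\<rbrakk>
         \<Longrightarrow> icomp P \<Gamma> G s (icomp P (contract \<Gamma> G s) H t x z) y =
             icomp P \<Gamma> H t (icomp P (contract \<Gamma> H t) G s x y) z"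

locale contractad_morphism = P: contractad P + Q: contractad Q
  for P :: "('k::field, 'v, 'x::ab_group_add) contractad_data"
    and Q :: "('k, 'v, 'y::ab_group_add) contractad_data" +
  fixes \<phi> :: "'v graph \<Rightarrow> 'x \<Rightarrow> 'y"
  assumes morph_closed: "\<lbrakk>connected_graph \<Gamma>; x \<in> carr P \<Gamma>\<rbrakk> \<Longrightarrow> \<phi> \<Gamma> x \<in> carr Q \<Gamma>"
    and morph_add:
      "\<lbrakk>connected_graph \<Gamma>; x \<in> carr P \<Gamma>; y \<in> carr P \<Gamma>\<rbrakk> \<Longrightarrow> \<phi> \<Gamma> (x + y) = \<phi> \<Gamma> x + \<phi> \<Gamma> y"
    and morph_scale:
      "\<lbrakk>connected_graph \<Gamma>; x \<in> carr P \<Gamma>\<rbrakk> \<Longrightarrow> \<phi> \<Gamma> (scl P c x) = scl Q c (\<phi> \<Gamma> x)"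
    and morph_act:
      "\<lbrakk>connected_graph \<Gamma>; inj_on f (verts \<Gamma>); x \<in> carr P \<Gamma>\<rbrakk>
         \<Longrightarrow> \<phi> (map_graph f \<Gamma>) (act P \<Gamma> f x) = act Q \<Gamma> f (\<phi> \<Gamma> x)"
    and morph_unit: "\<phi> (path_graph [v]) (cunit P v) = cunit Q v"
    and morph_icomp:
      "\<lbrakk>connected_graph \<Gamma>; tube_name \<Gamma> G s; x \<in> carr P (contract \<Gamma> G s); y \<in> carr P (induced \<Gamma> G)\<rbrakk>
         \<Longrightarrow> \<phi> \<Gamma> (icomp P \<Gamma> G s x y) =
             icomp Q \<Gamma> G s (\<phi> (contract \<Gamma> G s) x) (\<phi> (induced \<Gamma> G) y)"

definition subcollection ::
  "('k::field, 'v, 'x::ab_group_add) contractad_data \<Rightarrow> ('v graph \<Rightarrow> 'x set) \<Rightarrow> bool" where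
  "subcollection P S \<longleftrightarrow>
     (\<forall>\<Gamma>. connected_graph \<Gamma> \<longrightarrow>
        S \<Gamma> \<subseteq> carr P \<Gamma> \<and> module.subspace (scl P) (S \<Gamma>) \<and>
        (\<forall>f x. inj_on f (verts \<Gamma>) \<longrightarrow> x \<in> S \<Gamma> \<longrightarrow> act P \<Gamma> f x \<in> S (map_graph f \<Gamma>)))"

definition contractad_ideal ::
  "('k::field, 'v, 'x::ab_group_add) contractad_data \<Rightarrow> ('v graph \<Rightarrow> 'x set) \<Rightarrow> bool" where
  "contractad_ideal P I \<longleftrightarrow> subcollection P I \<and>
     (\<forall>\<Gamma> G s x y. connected_graph \<Gamma> \<longrightarrow> tube_name \<Gamma> G s \<longrightarrow>
        x \<in> carr P (contract \<Gamma> G s) \<longrightarrow> y \<in> carr P (induced \<Gamma> G) \<longrightarrow>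
        x \<in> I (contract \<Gamma> G s) \<or> y \<in> I (induced \<Gamma> G) \<longrightarrow>
        icomp P \<Gamma> G s x y \<in> I \<Gamma>)"

definition ideal_generated ::
  "('k::field, 'v, 'x::ab_group_add) contractad_data \<Rightarrow> ('v graph \<Rightarrow> 'x set) \<Rightarrow> 'v graph \<Rightarrow> 'x set"
  where
  "ideal_generated P R \<Gamma> =
     \<Inter>{I \<Gamma> | I. contractad_ideal P I \<and> (\<forall>\<Delta>. connected_graph \<Delta> \<longrightarrow> R \<Delta> \<subseteq> I \<Delta>)}"

definition subcontractad ::
  "('k::field, 'v, 'x::ab_group_add) contractad_data \<Rightarrow> ('v graph \<Rightarrow> 'x set) \<Rightarrow> bool" where
  "subcontractad P S \<longleftrightarrow> subcollection P S \<and> (\<forall>v. cunit P v \<in> S (path_graph [v])) \<and>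
     (\<forall>\<Gamma> G s x y. connected_graph \<Gamma> \<longrightarrow> tube_name \<Gamma> G s \<longrightarrow>
        x \<in> S (contract \<Gamma> G s) \<longrightarrow> y \<in> S (induced \<Gamma> G) \<longrightarrow> icomp P \<Gamma> G s x y \<in> S \<Gamma>)"

definition subcontractad_generated ::
  "('k::field, 'v, 'x::ab_group_add) contractad_data \<Rightarrow> ('v graph \<Rightarrow> 'x set) \<Rightarrow> 'v graph \<Rightarrow> 'x set"
  where
  "subcontractad_generated P E \<Gamma> =
     \<Inter>{S \<Gamma> | S. subcontractad P S \<and> (\<forall>\<Delta>. connected_graph \<Delta> \<longrightarrow> E \<Delta> \<subseteq> S \<Delta>)}"

section \<open>Linear extension of operations on bases\<close>

definition free_scale :: "'k::field \<Rightarrow> ('b \<Rightarrow>\<^sub>0 'k) \<Rightarrow> ('b \<Rightarrow>\<^sub>0 'k)" where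
  "free_scale c x = Poly_Mapping.map ((*) c) x"

definition free_space :: "'b set \<Rightarrow> ('b \<Rightarrow>\<^sub>0 'k::field) set" where
  "free_space B = {x. Poly_Mapping.keys x \<subseteq> B}"

abbreviation basis :: "'b \<Rightarrow> ('b \<Rightarrow>\<^sub>0 'k::field)" where
  "basis b \<equiv> Poly_Mapping.single b 1"

definition free_map :: "('b \<Rightarrow> 'c) \<Rightarrow> ('b \<Rightarrow>\<^sub>0 'k::field) \<Rightarrow> ('c \<Rightarrow>\<^sub>0 'k)" where
  "free_map h x = (\<Sum>b \<in> Poly_Mapping.keys x. Poly_Mapping.single (h b) (Poly_Mapping.lookup x b))"

definition free_map2 ::
  "('b \<Rightarrow> 'c \<Rightarrow> 'd) \<Rightarrow> ('b \<Rightarrow>\<^sub>0 'k::field) \<Rightarrow> ('c \<Rightarrow>\<^sub>0 'k) \<Rightarrow> ('d \<Rightarrow>\<^sub>0 'k)" where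
  "free_map2 h x y =
     (\<Sum>b \<in> Poly_Mapping.keys x. \<Sum>c \<in> Poly_Mapping.keys y.
        Poly_Mapping.single (h b c) (Poly_Mapping.lookup x b * Poly_Mapping.lookup y c))"

section \<open>The contractads BiPlan and PlanEq\<close>

datatype 'v ptree = Leaf 'v | Node "'v ptree" "'v ptree"

fun leaves :: "'v ptree \<Rightarrow> 'v list" where
  "leaves (Leaf v) = [v]"
| "leaves (Node l r) = leaves l @ leaves r"

fun subtrees :: "'v ptree \<Rightarrow> 'v ptree set" where
  "subtrees (Leaf v) = {Leaf v}"
| "subtrees (Node l r) = insert (Node l r) (subtrees l \<union> subtrees r)"

fun graft :: "'v \<Rightarrow> 'v ptree \<Rightarrow> 'v ptree \<Rightarrow> 'v ptree" where
  "graft s (Leaf v) u = (if v = s then u else Leaf v)"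
| "graft s (Node l r) u = Node (graft s l u) (graft s r u)"

definition admissible :: "'v graph \<Rightarrow> 'v ptree \<Rightarrow> bool" where
  "admissible \<Gamma> t \<longleftrightarrow> distinct (leaves t) \<and> set (leaves t) = verts \<Gamma> \<and>
     (\<forall>u \<in> subtrees t. tube \<Gamma> (set (leaves u)))"

definition BiPlan :: "('k::field, 'v, 'v ptree \<Rightarrow>\<^sub>0 'k) contractad_data" where
  "BiPlan =
     \<lparr>scl = free_scale,
      carr = (\<lambda>\<Gamma>. free_space {t. admissible \<Gamma> t}),
      act = (\<lambda>\<Gamma> f. free_map (map_ptree f)),
      cunit = (\<lambda>v. basis (Leaf v)),
      icomp = (\<lambda>\<Gamma> G s. free_map2 (graft s))\<rparr>"

definition insert_word :: "'v \<Rightarrow> 'v list \<Rightarrow> 'v list \<Rightarrow> 'v list" where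
  "insert_word s us ws = concat (map (\<lambda>u. if u = s then ws else [u]) us)"

definition PlanEq :: "('k::field, 'v, 'v list \<Rightarrow>\<^sub>0 'k) contractad_data" where
  "PlanEq =
     \<lparr>scl = free_scale,
      carr = (\<lambda>\<Gamma>. free_space (leaves ` {t. admissible \<Gamma> t})),
      act = (\<lambda>\<Gamma> f. free_map (map f)),
      cunit = (\<lambda>v. basis [v]),
      icomp = (\<lambda>\<Gamma> G s. free_map2 (insert_word s))\<rparr>"

definition leaf_word :: "'v graph \<Rightarrow> ('v ptree \<Rightarrow>\<^sub>0 'k::field) \<Rightarrow> ('v list \<Rightarrow>\<^sub>0 'k)" where
  "leaf_word \<Gamma> = free_map leaves"

definition assoc_relations :: "'v graph \<Rightarrow> ('v ptree \<Rightarrow>\<^sub>0 'k::field) set" where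
  "assoc_relations \<Gamma> = module.span free_scale
     {basis (Node (Node (Leaf v1) (Leaf v2)) (Leaf v3)) -
      basis (Node (Leaf v1) (Node (Leaf v2) (Leaf v3))) | v1 v2 v3.
        connected_graph \<Gamma> \<and> distinct [v1, v2, v3] \<and> verts \<Gamma> = {v1, v2, v3} \<and>
        {v1, v2} \<in> edges \<Gamma> \<and> {v2, v3} \<in> edges \<Gamma>}"

end

theory Submission
  imports Defs
begin

text \<open>
  Two admissible trees with the same leaf word are congruent modulo the relations: rotate
  \<open>(A(BC))\<close> to \<open>((AB)C)\<close> whenever \<open>A \<union> B\<close> is a tube, until no such rotation is possible. The
  result is determined by the word. If two such normal trees \<open>(LR)\<close> and \<open>(L'R')\<close>, with \<open>L\<close>
  shorter than \<open>L'\<close>, had the same word, then a smallest subtree of \<open>L'\<close> straddling two consecutive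
  blocks of the right spine of \<open>(LR)\<close> would provide an edge between these blocks, hence a rotation
  of \<open>(LR)\<close>. So the kernel is spanned by differences of congruent trees.
\<close>

section \<open>Linear extension\<close>

text \<open>Normality therefore depends on the edges, and so must the proof that normal trees are
  unique. A second obstacle is that the relations speak of three leaves, while a rotation moves
  three subtrees, and an ideal is closed under one composition at a time. The subtrees are
  contracted to vertices and grafted back one by one, so each intermediate rotation has to be known
  on every graph on which its two trees are admissible. A contracted subtree is named by the first
  of its own leaves, which cannot collide with the other vertices. Tubes are treated through cuts
  instead of paths, because cuts of a contraction correspond directly to cuts of the original graph
  that do not split the contracted tube.\<close>

lemma lookup_free_scale [simp]:
  "Poly_Mapping.lookup (free_scale c x) k = c * Poly_Mapping.lookup x k"
  unfolding free_scale_def by (auto simp: Poly_Mapping.map.rep_eq when_def)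

interpretation free: vector_space "free_scale :: 'k::field \<Rightarrow> ('b \<Rightarrow>\<^sub>0 'k) \<Rightarrow> ('b \<Rightarrow>\<^sub>0 'k)"
  by unfold_locales (auto intro!: poly_mapping_eqI simp: lookup_add algebra_simps)

lemma keys_free_scale: "Poly_Mapping.keys (free_scale c x) \<subseteq> Poly_Mapping.keys x"
  by (auto simp: in_keys_iff)

lemma subspace_free_space: "free.subspace (free_space B)"
  unfolding free.subspace_def free_space_def
  by (auto dest!: subsetD[OF keys_free_scale] subsetD[OF Poly_Mapping.keys_add])

lemma basis_in_free_space [simp]: "basis b \<in> free_space B \<longleftrightarrow> b \<in> B"
  by (auto simp: free_space_def)

text \<open>The universal property of the free vector space. Both \<open>free_map\<close> and
  \<open>free_map2\<close> are instances or iterations of it, so that multilinear identities reduce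
  to \<open>lin_lin\<close>, \<open>lin_swap\<close> and \<open>lin_cong\<close>.\<close>

definition lin :: "('b \<Rightarrow> ('c \<Rightarrow>\<^sub>0 'k::field)) \<Rightarrow> ('b \<Rightarrow>\<^sub>0 'k) \<Rightarrow> ('c \<Rightarrow>\<^sub>0 'k)" where
  "lin F x = (\<Sum>b \<in> Poly_Mapping.keys x. free_scale (Poly_Mapping.lookup x b) (F b))"

text \<open>Supports differ from vector to vector; a common finite index set makes their sums
  comparable.\<close>

lemma lin_superset:
  assumes "finite A" "Poly_Mapping.keys x \<subseteq> A"
  shows "lin F x = (\<Sum>b \<in> A. free_scale (Poly_Mapping.lookup x b) (F b))"
  unfolding lin_def using assms
  by (intro sum.mono_neutral_left) (auto simp: in_keys_iff)

lemma lin_add: "lin F (x + y) = lin F x + lin F y"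
proof -
  let ?A = "Poly_Mapping.keys x \<union> Poly_Mapping.keys y"
  have "lin F z = (\<Sum>b\<in>?A. free_scale (Poly_Mapping.lookup z b) (F b))" if "z \<in> {x, y, x + y}" for z
    using that Poly_Mapping.keys_add[of x y] by (intro lin_superset) auto
  then show ?thesis
    by (simp add: lookup_add free.scale_left_distrib sum.distrib)
qed

lemma lin_scale: "lin F (free_scale c x) = free_scale c (lin F x)"
  using lin_superset[OF _ keys_free_scale, of x F c]
  by (simp add: lin_def free.scale_sum_right)

lemma lin_zero [simp]: "lin F 0 = 0" "lin (\<lambda>_. 0) x = 0"
  by (simp_all add: lin_def)

lemma lin_diff: "lin F (x - y) = lin F x - lin F y"
  by (metis add_diff_cancel_right' diff_add_cancel lin_add)

lemma lin_sum: "lin F (\<Sum>a\<in>A. g a) = (\<Sum>a\<in>A. lin F (g a))"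
  by (induction A rule: infinite_finite_induct) (auto simp: lin_add)

lemma lin_basis [simp]: "lin F (basis b) = F b"
  by (simp add: lin_def)

lemma lin_basis_id: "lin basis x = x"
proof (rule poly_mapping_eqI)
  fix k
  show "Poly_Mapping.lookup (lin basis x) k = Poly_Mapping.lookup x k"
    by (simp add: lin_def lookup_sum lookup_single when_def if_distrib[of "(*) _"] in_keys_iff
        cong: if_cong)
qed

lemma lin_cong: "(\<And>b. b \<in> Poly_Mapping.keys x \<Longrightarrow> F b = G b) \<Longrightarrow> lin F x = lin G x"
  by (auto simp: lin_def intro: sum.cong)

lemma lin_lin: "lin F (lin G x) = lin (\<lambda>b. lin F (G b)) x"
  unfolding lin_def[of G] lin_def[of "\<lambda>b. lin F (G b)"] by (simp add: lin_sum lin_scale)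

text \<open>Exchange of two finite sums. It serves parallel composition, where two inner arguments
  are inserted in opposite orders.\<close>

lemma lin_swap: "lin (\<lambda>b. lin (F b) y) x = lin (\<lambda>c. lin (\<lambda>b. F b c) x) y"
  unfolding lin_def
  by (simp add: free.scale_sum_right mult.commute) (rule sum.swap)

lemma lin_closed:
  assumes "free.subspace S" "\<And>b. b \<in> Poly_Mapping.keys x \<Longrightarrow> F b \<in> S"
  shows "lin F x \<in> S"
  unfolding lin_def using assms
  by (intro free.subspace_sum) (auto intro: free.subspace_scale)

lemma lin_add_fun: "lin (\<lambda>b. F b + G b) x = lin F x + lin G x"
  by (simp add: lin_def free.scale_right_distrib sum.distrib)

lemma lin_diff_fun: "lin (\<lambda>b. F b - G b) x = lin F x - lin G x"
  by (simp add: lin_def free.scale_right_diff_distrib sum_subtractf)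

lemma lin_scale_fun: "lin (\<lambda>b. free_scale c (F b)) x = free_scale c (lin F x)"
  by (simp add: lin_def free.scale_sum_right mult.commute)

lemma single_eq_scale: "Poly_Mapping.single b c = free_scale c (basis b)"
  by (rule poly_mapping_eqI) (simp add: lookup_single when_def)

lemma free_map_lin: "free_map h = lin (\<lambda>b. basis (h b))"
  by (rule ext) (simp add: free_map_def lin_def single_eq_scale[of _ "Poly_Mapping.lookup _ _"])

lemma free_map2_lin: "free_map2 h x y = lin (\<lambda>b. lin (\<lambda>c. basis (h b c)) y) x"
  by (simp add: free_map2_def lin_def free.scale_sum_right
      single_eq_scale[of _ "Poly_Mapping.lookup _ _ * Poly_Mapping.lookup _ _"])

lemma free_map2_diff_left: "free_map2 h (x - x') y = free_map2 h x y - free_map2 h x' y"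
  by (simp add: free_map2_lin lin_diff)

lemma free_map2_diff_right: "free_map2 h x (y - y') = free_map2 h x y - free_map2 h x y'"
  by (simp add: free_map2_lin lin_diff lin_diff_fun)

lemma free_map2_basis: "free_map2 h (basis x) (basis y) = basis (h x y)"
  by (simp add: free_map2_lin)

lemma free_space_keys: "x \<in> free_space B \<Longrightarrow> b \<in> Poly_Mapping.keys x \<Longrightarrow> b \<in> B"
  by (auto simp: free_space_def)

section \<open>Contractads in sets and their linearization\<close>

locale set_contractad =
  fixes B :: "'v graph \<Rightarrow> 'b set"
    and m :: "('v \<Rightarrow> 'v) \<Rightarrow> 'b \<Rightarrow> 'b"
    and e :: "'v \<Rightarrow> 'b"
    and c :: "'v \<Rightarrow> 'b \<Rightarrow> 'b \<Rightarrow> 'b"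
  assumes m_closed:
      "\<lbrakk>connected_graph \<Gamma>; inj_on f (verts \<Gamma>); x \<in> B \<Gamma>\<rbrakk> \<Longrightarrow> m f x \<in> B (map_graph f \<Gamma>)"
    and m_cong:
      "\<lbrakk>connected_graph \<Gamma>; \<And>v. v \<in> verts \<Gamma> \<Longrightarrow> f v = g v; x \<in> B \<Gamma>\<rbrakk> \<Longrightarrow> m f x = m g x"
    and m_id: "m id x = x"
    and m_comp: "m g (m f x) = m (g \<circ> f) x"
    and e_closed: "e v \<in> B (path_graph [v])"
    and m_e: "m f (e v) = e (f v)"
    and c_closed:
      "\<lbrakk>connected_graph \<Gamma>; tube_name \<Gamma> G s; x \<in> B (contract \<Gamma> G s); y \<in> B (induced \<Gamma> G)\<rbrakk>
         \<Longrightarrow> c s x y \<in> B \<Gamma>"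
    and m_c:
      "\<lbrakk>connected_graph \<Gamma>; tube_name \<Gamma> G s; inj_on f (verts \<Gamma>); t \<notin> f ` (verts \<Gamma> - G);
        x \<in> B (contract \<Gamma> G s); y \<in> B (induced \<Gamma> G)\<rbrakk>
         \<Longrightarrow> m f (c s x y) = c t (m (f(s := t)) x) (m f y)"
    and c_e_left: "c s (e s) x = x"
    and c_e_right: "c s x (e v) = m (id(s := v)) x"
    and c_nested:
      "\<lbrakk>connected_graph \<Gamma>; tube_name \<Gamma> G s; tube_name \<Gamma> H t; G \<subseteq> H;
        x \<in> B (contract \<Gamma> H t); y \<in> B (contract (induced \<Gamma> H) G s); z \<in> B (induced \<Gamma> G)\<rbrakk>
         \<Longrightarrow> c t x (c s y z) = c s (c t x y) z"
    and c_disjoint: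
      "\<lbrakk>connected_graph \<Gamma>; tube_name \<Gamma> G s; tube_name \<Gamma> H t; G \<inter> H = {}; s \<noteq> t;
        x \<in> B (contract (contract \<Gamma> G s) H t); y \<in> B (induced \<Gamma> G); z \<in> B (induced \<Gamma> H)\<rbrakk>
         \<Longrightarrow> c s (c t x z) y = c t (c s x y) z"
begin

text \<open>Every contractad axiom is closure or an identity between multilinear maps, so it may be
  checked on the basis elements in the supports of the arguments. These lie in the sets
  \<open>B\<close>, where the axioms of the locale apply.\<close>

lemma contractad_linearization:
  "contractad \<lparr>scl = free_scale :: 'k::field \<Rightarrow> _, carr = (\<lambda>\<Gamma>. free_space (B \<Gamma>)),
     act = (\<lambda>\<Gamma> f. free_map (m f)), cunit = (\<lambda>v. basis (e v)), icomp = (\<lambda>\<Gamma> G s. free_map2 (c s))\<rparr>"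
proof (rule contractad.intro, goal_cases)
  case 1 show ?case by (simp add: free.vector_space_axioms)
next
  case (3 \<Gamma> f x)
  then show ?case
    by (auto simp: free_map_lin subspace_free_space intro!: lin_closed m_closed dest: free_space_keys)
next
  case (6 \<Gamma> f g x)
  then show ?case
    by (auto simp: free_map_lin intro!: lin_cong m_cong[THEN arg_cong] dest: free_space_keys)
next
  case (9 v)
  show ?case by (simp add: e_closed)
next
  case (11 \<Gamma> G s x y)
  then show ?case
    by (auto simp: free_map2_lin subspace_free_space intro!: lin_closed c_closed dest: free_space_keys)
next
  case (16 \<Gamma> G s f t x y)
  then show ?case
    by (auto simp: free_map2_lin free_map_lin lin_lin intro!: lin_cong m_c[THEN arg_cong]
        dest: free_space_keys)
next
  case (19 \<Gamma> G s H t x y z)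
  then show ?case
    by (auto simp: free_map2_lin lin_lin intro!: lin_cong c_nested[THEN arg_cong]
        dest: free_space_keys)
next
  case (20 \<Gamma> G s H t x y z)
  have "lin (\<lambda>b. lin (\<lambda>d. lin (\<lambda>b'. basis (c s (c t b d) b')) y) z) x
      = (lin (\<lambda>b. lin (\<lambda>d. lin (\<lambda>b'. basis (c t (c s b b') d)) y) z) x :: 'b \<Rightarrow>\<^sub>0 'k)"
    using 20 by (auto intro!: lin_cong c_disjoint[THEN arg_cong] dest: free_space_keys)
  \<comment> \<open>The two sides sum over \<open>y\<close> and \<open>z\<close> in opposite
    orders.\<close>
  also have "\<dots> = lin (\<lambda>b. lin (\<lambda>b'. lin (\<lambda>d. basis (c t (c s b b') d)) z) y) x"
    by (subst lin_swap) simp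
  finally show ?case by (simp add: free_map2_lin lin_lin)
qed (simp_all add: subspace_free_space free_map_lin free_map2_lin lin_add lin_scale lin_add_fun
    lin_scale_fun lin_lin lin_basis_id m_id m_comp m_e c_e_left c_e_right)

end

section \<open>Connectedness by cuts\<close>

text \<open>Connectedness as the absence of a cut without crossing edge. This form passes to unions,
  images and preimages under contraction without any handling of paths.\<close>

definition cut_connected :: "'v set set \<Rightarrow> 'v set \<Rightarrow> bool" where
  "cut_connected E S \<longleftrightarrow>
     S \<noteq> {} \<and> (\<forall>A. A \<subset> S \<longrightarrow> A \<noteq> {} \<longrightarrow> (\<exists>u\<in>A. \<exists>v\<in>S - A. {u, v} \<in> E))"

lemma cut_connectedD:
  "\<lbrakk>cut_connected E S; A \<subset> S; A \<noteq> {}\<rbrakk> \<Longrightarrow> \<exists>u\<in>A. \<exists>v\<in>S - A. {u, v} \<in> E"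
  by (auto simp: cut_connected_def)

lemma cut_connected_singleton [simp]: "cut_connected E {v}"
  by (auto simp: cut_connected_def)

text \<open>A proper nonempty part of \<open>S \<union> T\<close> either splits \<open>S\<close> or
  \<open>T\<close>, and a crossing edge is found there, or it is exactly one of two disjoint sets
  \<open>S\<close> and \<open>T\<close>, and then \<open>{u, v}\<close> crosses.\<close>

lemma cut_connected_Un:
  assumes S: "cut_connected E S" and T: "cut_connected E T" and "u \<in> S" "v \<in> T" "{u, v} \<in> E"
  shows "cut_connected E (S \<union> T)"
  unfolding cut_connected_def
proof (intro conjI allI impI)
  fix A assume A: "A \<subset> S \<union> T" "A \<noteq> {}"
  consider "A \<inter> S \<noteq> {}" "\<not> S \<subseteq> A" | "A \<inter> T \<noteq> {}" "\<not> T \<subseteq> A" | "A = S" "S \<inter> T = {}" | "A = T" "S \<inter> T = {}"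
    using A by blast
  then show "\<exists>u\<in>A. \<exists>v\<in>S \<union> T - A. {u, v} \<in> E"
  proof cases
    case 1 then show ?thesis using cut_connectedD[OF S, of "A \<inter> S"] by blast
  next
    case 2 then show ?thesis using cut_connectedD[OF T, of "A \<inter> T"] by blast
  next
    case 3 then show ?thesis using assms by blast
  next
    case 4 then show ?thesis using assms by (metis Diff_iff Un_iff disjoint_iff insert_commute)
  qed
qed (use S in \<open>auto simp: cut_connected_def\<close>)

lemma simple_graphD:
  "\<lbrakk>simple_graph \<Gamma>; e \<in> edges \<Gamma>\<rbrakk> \<Longrightarrow> \<exists>u v. e = {u, v} \<and> u \<in> verts \<Gamma> \<and> v \<in> verts \<Gamma> \<and> u \<noteq> v"
  by (auto simp: simple_graph_def)

text \<open>A set that no edge leaves traps every path starting in it; conversely, no edge leaves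
  the set of vertices reachable from a given one.\<close>

lemma connected_graph_iff:
  "connected_graph \<Gamma> \<longleftrightarrow> simple_graph \<Gamma> \<and> cut_connected (edges \<Gamma>) (verts \<Gamma>)"
proof (cases "simple_graph \<Gamma>")
  case True
  let ?r = "{(x, y). {x, y} \<in> edges \<Gamma>}"
  have verts: "x \<in> verts \<Gamma>" "y \<in> verts \<Gamma>" if "{x, y} \<in> edges \<Gamma>" for x y
    using simple_graphD[OF True that] by (auto simp: doubleton_eq_iff)
  show ?thesis
  proof
    assume conn: "connected_graph \<Gamma>"
    show "simple_graph \<Gamma> \<and> cut_connected (edges \<Gamma>) (verts \<Gamma>)"
      unfolding cut_connected_def
    proof (intro conjI allI impI True)
      show "verts \<Gamma> \<noteq> {}" using conn by (simp add: connected_graph_def)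
      fix A assume A: "A \<subset> verts \<Gamma>" "A \<noteq> {}"
      show "\<exists>u\<in>A. \<exists>v\<in>verts \<Gamma> - A. {u, v} \<in> edges \<Gamma>"
      proof (rule ccontr)
        assume no: "\<not> ?thesis"
        obtain x y where xy: "x \<in> A" "y \<in> verts \<Gamma>" "y \<notin> A" using A by blast
        have "(x, y) \<in> ?r\<^sup>*" using conn xy A by (auto simp: connected_graph_def)
        then have "y \<in> A"
        proof (induction rule: rtrancl_induct)
          case base show ?case by (fact xy(1))
        next
          case (step y z) then show ?case using no verts(2)[of y z] by blast
        qed
        then show False using xy by simp
      qed
    qed
  next
    assume cut: "simple_graph \<Gamma> \<and> cut_connected (edges \<Gamma>) (verts \<Gamma>)"
    have "(x, y) \<in> ?r\<^sup>*" if x: "x \<in> verts \<Gamma>" and y: "y \<in> verts \<Gamma>" for x y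
    proof (rule ccontr)
      assume no: "(x, y) \<notin> ?r\<^sup>*"
      let ?A = "{z \<in> verts \<Gamma>. (x, z) \<in> ?r\<^sup>*}"
      have "?A \<subset> verts \<Gamma>" "?A \<noteq> {}" using no x y by blast+
      then obtain u v where uv: "(x, u) \<in> ?r\<^sup>*" "{u, v} \<in> edges \<Gamma>" "(x, v) \<notin> ?r\<^sup>*"
        using cut_connectedD[OF conjunct2[OF cut], of ?A] by auto
      then show False by (auto intro: rtrancl_into_rtrancl)
    qed
    then show "connected_graph \<Gamma>"
      using cut by (auto simp: connected_graph_def cut_connected_def)
  qed
qed (auto simp: connected_graph_def)

lemma cut_connected_induced:
  "cut_connected {e \<in> E. e \<subseteq> G} S \<longleftrightarrow> cut_connected E S" if "S \<subseteq> G"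
proof -
  have "(\<exists>u\<in>A. \<exists>v\<in>S - A. {u, v} \<in> E \<and> {u, v} \<subseteq> G) \<longleftrightarrow> (\<exists>u\<in>A. \<exists>v\<in>S - A. {u, v} \<in> E)"
    if "A \<subset> S" for A
    using that \<open>S \<subseteq> G\<close> by blast
  then show ?thesis by (auto simp: cut_connected_def)
qed

section \<open>Induced subgraphs, relabelled graphs and contractions\<close>

lemma verts_induced [simp]: "verts (induced \<Gamma> G) = G"
  and edges_induced [simp]: "edges (induced \<Gamma> G) = {e \<in> edges \<Gamma>. e \<subseteq> G}"
  by (simp_all add: induced_def)

lemma verts_contract [simp]: "verts (contract \<Gamma> G s) = insert s (verts \<Gamma> - G)"
  by (simp add: contract_def Let_def)

lemma verts_map_graph [simp]: "verts (map_graph f \<Gamma>) = f ` verts \<Gamma>"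
  and edges_map_graph [simp]: "edges (map_graph f \<Gamma>) = (`) f ` edges \<Gamma>"
  by (simp_all add: map_graph_def)

lemma simple_induced:
  assumes "simple_graph \<Gamma>" "G \<subseteq> verts \<Gamma>"
  shows "simple_graph (induced \<Gamma> G)"
  unfolding simple_graph_def
proof (intro conjI subsetI)
  show "finite (verts (induced \<Gamma> G))" using assms by (auto simp: simple_graph_def intro: finite_subset)
  fix e assume "e \<in> edges (induced \<Gamma> G)"
  then show "e \<in> {{u, v} | u v. u \<in> verts (induced \<Gamma> G) \<and> v \<in> verts (induced \<Gamma> G) \<and> u \<noteq> v}"
    using simple_graphD[OF assms(1), of e] by auto
qed

lemma induced_verts [simp]: "simple_graph \<Gamma> \<Longrightarrow> induced \<Gamma> (verts \<Gamma>) = \<Gamma>"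
  using simple_graphD[of \<Gamma>] by (cases \<Gamma>) (fastforce simp: induced_def)

lemma simple_map_graph:
  assumes "simple_graph \<Gamma>" "inj_on f (verts \<Gamma>)"
  shows "simple_graph (map_graph f \<Gamma>)"
  unfolding simple_graph_def
proof (intro conjI subsetI)
  show "finite (verts (map_graph f \<Gamma>))" using assms by (auto simp: simple_graph_def)
  fix e assume "e \<in> edges (map_graph f \<Gamma>)"
  then obtain e' where e': "e' \<in> edges \<Gamma>" "e = f ` e'" by auto
  obtain u v where "e' = {u, v}" "u \<in> verts \<Gamma>" "v \<in> verts \<Gamma>" "u \<noteq> v"
    using simple_graphD[OF assms(1) e'(1)] by blast
  then show "e \<in> {{u, v} | u v. u \<in> verts (map_graph f \<Gamma>) \<and> v \<in> verts (map_graph f \<Gamma>) \<and> u \<noteq> v}"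
    using e' assms(2) by (auto dest: inj_onD)
qed

lemma simple_contract:
  assumes "simple_graph \<Gamma>" "s \<notin> verts \<Gamma> - G"
  shows "simple_graph (contract \<Gamma> G s)"
  unfolding simple_graph_def
proof (intro conjI subsetI)
  show "finite (verts (contract \<Gamma> G s))" using assms by (auto simp: simple_graph_def)
  fix e assume "e \<in> edges (contract \<Gamma> G s)"
  then obtain e' where e': "e' \<in> edges \<Gamma>" "\<not> e' \<subseteq> G" "e = (\<lambda>v. if v \<in> G then s else v) ` e'"
    by (auto simp: contract_def Let_def)
  obtain u v where "e' = {u, v}" "u \<in> verts \<Gamma>" "v \<in> verts \<Gamma>" "u \<noteq> v"
    using simple_graphD[OF assms(1) e'(1)] by blast
  then show "e \<in> {{u, v} | u v. u \<in> verts (contract \<Gamma> G s) \<and> v \<in> verts (contract \<Gamma> G s) \<and> u \<noteq> v}"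
    using e' assms(2) by (cases "u \<in> G"; cases "v \<in> G") auto
qed

lemma tube_iff:
  assumes "simple_graph \<Gamma>"
  shows "tube \<Gamma> G \<longleftrightarrow> G \<subseteq> verts \<Gamma> \<and> cut_connected (edges \<Gamma>) G"
  using assms simple_induced
  by (auto simp: tube_def connected_graph_iff cut_connected_induced) (auto simp: cut_connected_def)

text \<open>The fibres of the quotient map onto \<open>contract \<Gamma> G s\<close>.\<close>

definition fibre :: "'v set \<Rightarrow> 'v \<Rightarrow> 'v \<Rightarrow> 'v set" where
  "fibre G s u = (if u = s then G else {u})"

lemma edge_contract_iff:
  assumes "simple_graph \<Gamma>" "s \<notin> verts \<Gamma> - G"
    and "u \<in> verts (contract \<Gamma> G s)" "v \<in> verts (contract \<Gamma> G s)" "u \<noteq> v"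
  shows "{u, v} \<in> edges (contract \<Gamma> G s) \<longleftrightarrow>
    (\<exists>p\<in>fibre G s u. \<exists>r\<in>fibre G s v. {p, r} \<in> edges \<Gamma>)"
proof
  let ?q = "\<lambda>v. if v \<in> G then s else v"
  assume "{u, v} \<in> edges (contract \<Gamma> G s)"
  then obtain e where e: "e \<in> edges \<Gamma>" "{u, v} = ?q ` e"
    by (auto simp: contract_def Let_def)
  obtain p r where pr: "e = {p, r}" "p \<in> verts \<Gamma>" "r \<in> verts \<Gamma>" "p \<noteq> r"
    using simple_graphD[OF assms(1) e(1)] by blast
  \<comment> \<open>This is where \<open>s\<close> must avoid \<open>verts \<Gamma> - G\<close>: a
    vertex outside \<open>G\<close> called \<open>s\<close> would have \<open>G\<close> as the fibre
    of its image.\<close>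
  have fib: "x \<in> fibre G s (?q x)" if "x \<in> verts \<Gamma>" for x
    using that assms(2) by (auto simp: fibre_def)
  have "{u, v} = {?q p, ?q r}" using e pr by simp
  then consider "u = ?q p" "v = ?q r" | "u = ?q r" "v = ?q p"
    by (auto simp only: doubleton_eq_iff)
  then show "\<exists>p\<in>fibre G s u. \<exists>r\<in>fibre G s v. {p, r} \<in> edges \<Gamma>"
  proof cases
    case 1
    then show ?thesis using fib[OF pr(2)] fib[OF pr(3)] e(1) pr(1) by blast
  next
    case 2
    moreover have "{r, p} \<in> edges \<Gamma>" using e(1) pr(1) by (simp add: insert_commute)
    ultimately show ?thesis using fib[OF pr(2)] fib[OF pr(3)] by blast
  qed
next
  let ?q = "\<lambda>v. if v \<in> G then s else v"
  assume "\<exists>p\<in>fibre G s u. \<exists>r\<in>fibre G s v. {p, r} \<in> edges \<Gamma>"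
  then obtain p r where pr: "p \<in> fibre G s u" "r \<in> fibre G s v" "{p, r} \<in> edges \<Gamma>" by blast
  have "?q x = w" if "x \<in> fibre G s w" "w \<in> verts (contract \<Gamma> G s)" for x w
    using that by (auto simp: fibre_def split: if_splits)
  then have q: "?q p = u" "?q r = v" using assms pr by blast+
  then have "{u, v} = ?q ` {p, r}" by (simp only: image_insert image_empty)
  moreover have "\<not> {p, r} \<subseteq> G" using q assms(5) by auto
  ultimately show "{u, v} \<in> edges (contract \<Gamma> G s)"
    unfolding contract_def Let_def using pr(3) by (simp only: graph.select_convs) blast
qed

text \<open>Cuts of \<open>U\<close> pull back to cuts of the preimage, and a cut of the preimage
  that does not arise in this way splits \<open>G\<close>, where the connectedness of
  \<open>G\<close> provides the crossing edge. This lets tubes of a contraction be tested in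
  \<open>\<Gamma>\<close>.\<close>

lemma cut_connected_contract:
  assumes simple: "simple_graph \<Gamma>" and s: "s \<notin> verts \<Gamma> - G"
    and G: "cut_connected (edges \<Gamma>) G" and U: "U \<subseteq> verts (contract \<Gamma> G s)"
  shows "cut_connected (edges (contract \<Gamma> G s)) U \<longleftrightarrow> cut_connected (edges \<Gamma>) (\<Union> (fibre G s ` U))"
proof -
  have "G \<noteq> {}" using G by (simp add: cut_connected_def)
  then have ne: "fibre G s u \<noteq> {}" for u by (simp add: fibre_def)
  have disj: "u = v" if "p \<in> fibre G s u" "p \<in> fibre G s v" "u \<in> U" "v \<in> U" for p u v
    using that U by (auto simp: fibre_def split: if_splits)
  have edge: "{u, v} \<in> edges (contract \<Gamma> G s) \<longleftrightarrow>
      (\<exists>p\<in>fibre G s u. \<exists>r\<in>fibre G s v. {p, r} \<in> edges \<Gamma>)" if "u \<in> U" "v \<in> U" "u \<noteq> v" for u v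
    using edge_contract_iff[OF simple s] that U by blast
  show ?thesis
  proof
    assume cut: "cut_connected (edges (contract \<Gamma> G s)) U"
    show "cut_connected (edges \<Gamma>) (\<Union> (fibre G s ` U))"
      unfolding cut_connected_def
    proof (intro conjI allI impI)
      show "\<Union> (fibre G s ` U) \<noteq> {}" using cut ne by (auto simp: cut_connected_def)
      fix A assume A: "A \<subset> \<Union> (fibre G s ` U)" "A \<noteq> {}"
      show "\<exists>u\<in>A. \<exists>v\<in>\<Union> (fibre G s ` U) - A. {u, v} \<in> edges \<Gamma>"
      proof (cases "s \<in> U \<and> A \<inter> G \<noteq> {} \<and> \<not> G \<subseteq> A")
        case True
        then obtain u v where "u \<in> A \<inter> G" "v \<in> G - A \<inter> G" "{u, v} \<in> edges \<Gamma>"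
          using cut_connectedD[OF G, of "A \<inter> G"] by blast
        moreover have "G \<subseteq> \<Union> (fibre G s ` U)" using True by (force simp: fibre_def)
        ultimately show ?thesis by blast
      next
        case False
        \<comment> \<open>The cut of \<open>U\<close> whose preimage is \<open>A\<close>: as
          \<open>A\<close> does not split \<open>G\<close>, a fibre that meets \<open>A\<close> lies
          in \<open>A\<close>.\<close>
        let ?A = "{u \<in> U. fibre G s u \<subseteq> A}"
        have whole: "fibre G s u \<subseteq> A" if "u \<in> U" "p \<in> fibre G s u" "p \<in> A" for u p
          using that False by (auto simp: fibre_def split: if_splits)
        have "?A \<subset> U" "?A \<noteq> {}" using A whole by blast+
        then obtain u v where uv: "u \<in> ?A" "v \<in> U - ?A" "{u, v} \<in> edges (contract \<Gamma> G s)"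
          using cut_connectedD[OF cut, of ?A] by blast
        then obtain p r where pr: "p \<in> fibre G s u" "r \<in> fibre G s v" "{p, r} \<in> edges \<Gamma>"
          using edge[of u v] by blast
        have "r \<notin> A" using whole[of v r] uv pr by blast
        then show ?thesis using uv pr by blast
      qed
    qed
  next
    assume cut: "cut_connected (edges \<Gamma>) (\<Union> (fibre G s ` U))"
    show "cut_connected (edges (contract \<Gamma> G s)) U"
      unfolding cut_connected_def
    proof (intro conjI allI impI)
      show "U \<noteq> {}" using cut by (auto simp: cut_connected_def)
      fix A assume A: "A \<subset> U" "A \<noteq> {}"
      let ?A = "\<Union> (fibre G s ` A)"
      have "?A \<noteq> {}" using A ne by blast
      moreover have "?A \<subset> \<Union> (fibre G s ` U)"
      proof -
        obtain u where "u \<in> U" "u \<notin> A" using A by blast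
        moreover obtain p where "p \<in> fibre G s u" using ne by blast
        ultimately have "p \<notin> ?A" "p \<in> \<Union> (fibre G s ` U)" using disj A by blast+
        then show ?thesis using A by blast
      qed
      ultimately have "\<exists>p\<in>?A. \<exists>r\<in>\<Union> (fibre G s ` U) - ?A. {p, r} \<in> edges \<Gamma>"
        by (rule cut_connectedD[OF cut, rotated])
      then obtain p r where pr: "p \<in> ?A" "r \<in> \<Union> (fibre G s ` U) - ?A" "{p, r} \<in> edges \<Gamma>"
        by (elim bexE)
      then obtain u v where uv: "u \<in> A" "p \<in> fibre G s u" "v \<in> U" "r \<in> fibre G s v" by blast
      moreover have "v \<notin> A" using uv pr by blast
      ultimately have "{u, v} \<in> edges (contract \<Gamma> G s)" using edge[of u v] pr A by blast
      then show "\<exists>u\<in>A. \<exists>v\<in>U - A. {u, v} \<in> edges (contract \<Gamma> G s)"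
        using uv \<open>v \<notin> A\<close> by blast
    qed
  qed
qed

lemma cut_connected_image:
  assumes "cut_connected E S"
  shows "cut_connected ((`) f ` E) (f ` S)"
  unfolding cut_connected_def
proof (intro conjI allI impI)
  show "f ` S \<noteq> {}" using assms by (auto simp: cut_connected_def)
  fix A assume A: "A \<subset> f ` S" "A \<noteq> {}"
  let ?A = "{u \<in> S. f u \<in> A}"
  have "?A \<subset> S" "?A \<noteq> {}" using A by blast+
  then obtain u v where "u \<in> ?A" "v \<in> S - ?A" "{u, v} \<in> E"
    using cut_connectedD[OF assms, of ?A] by blast
  then have "f u \<in> A" "f v \<in> f ` S - A" "{f u, f v} \<in> (`) f ` E"
    by (auto intro: image_eqI[of _ _ "{u, v}"])
  then show "\<exists>u\<in>A. \<exists>v\<in>f ` S - A. {u, v} \<in> (`) f ` E" by blast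
qed

lemma connected_induced_tube: "tube \<Gamma> G \<Longrightarrow> connected_graph (induced \<Gamma> G)"
  by (simp add: tube_def)

lemma connected_contract:
  assumes "connected_graph \<Gamma>" "tube_name \<Gamma> G s"
  shows "connected_graph (contract \<Gamma> G s)"
proof -
  have *: "simple_graph \<Gamma>" "s \<notin> verts \<Gamma> - G" "cut_connected (edges \<Gamma>) G" "G \<subseteq> verts \<Gamma>"
    using assms by (auto simp: connected_graph_iff tube_name_def tube_iff)
  have "\<Union> (fibre G s ` verts (contract \<Gamma> G s)) = verts \<Gamma>"
    using * by (auto simp: fibre_def)
  then show ?thesis
    using cut_connected_contract[OF *(1-3) order_refl] assms *
    by (simp add: connected_graph_iff simple_contract)
qed

section \<open>Admissible trees\<close>

lemma leaves_not_Nil [simp]: "leaves t \<noteq> []"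
  by (induction t) auto

lemma leaves_map_ptree: "leaves (map_ptree f t) = map f (leaves t)"
  by (induction t) auto

lemma set_leaves: "set (leaves t) = set_ptree t"
  by (induction t) auto

lemma self_in_subtrees [simp]: "t \<in> subtrees t"
  by (cases t) auto

lemma leaves_subtrees: "u \<in> subtrees t \<Longrightarrow> set (leaves u) \<subseteq> set (leaves t)"
  by (induction t) auto

lemma insert_word_simps [simp]:
  "insert_word s [] ws = []"
  "insert_word s (u # us) ws = (if u = s then ws else [u]) @ insert_word s us ws"
  "insert_word s (us @ us') ws = insert_word s us ws @ insert_word s us' ws"
  by (simp_all add: insert_word_def)

lemma leaves_graft: "leaves (graft s x y) = insert_word s (leaves x) (leaves y)"
  by (induction x) auto

lemma set_insert_word: "set (insert_word s us ws) = \<Union> (fibre (set ws) s ` set us)"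
  by (induction us) (auto simp: fibre_def)

lemma distinct_insert_word:
  "\<lbrakk>distinct us; distinct ws; (set us - {s}) \<inter> set ws = {}\<rbrakk> \<Longrightarrow> distinct (insert_word s us ws)"
  by (induction us) (auto simp: set_insert_word fibre_def split: if_splits)

lemma graft_absent [simp]: "s \<notin> set (leaves x) \<Longrightarrow> graft s x y = x"
  by (induction x) auto

lemma map_ptree_graft:
  "(\<And>v. v \<in> set (leaves x) \<Longrightarrow> v \<noteq> s \<Longrightarrow> f v \<noteq> t) \<Longrightarrow>
     map_ptree f (graft s x y) = graft t (map_ptree (f(s := t)) x) (map_ptree f y)"
  by (induction x) auto

lemma graft_Leaf: "graft s x (Leaf v) = map_ptree (id(s := v)) x"
  by (induction x) auto

text \<open>The hypothesis keeps \<open>s\<close> out of the leaves of \<open>x\<close> but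
  tolerates \<open>s = t\<close>, since both names may be taken from inside the same tube.\<close>

lemma graft_nested:
  "(\<And>v. v \<in> set (leaves x) \<Longrightarrow> v \<noteq> t \<Longrightarrow> v \<noteq> s) \<Longrightarrow>
     graft t x (graft s y z) = graft s (graft t x y) z"
  by (induction x) auto

lemma graft_disjoint:
  "\<lbrakk>s \<notin> set (leaves z); t \<notin> set (leaves y); s \<noteq> t\<rbrakk> \<Longrightarrow>
     graft s (graft t x z) y = graft t (graft s x y) z"
  by (induction x) auto

text \<open>The part of admissibility that refers to the edges only. Subtrees inherit it without
  passing to an induced graph.\<close>

definition tree_connected :: "'v set set \<Rightarrow> 'v ptree \<Rightarrow> bool" where
  "tree_connected E t \<longleftrightarrow> (\<forall>u \<in> subtrees t. cut_connected E (set (leaves u)))"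

lemma tree_connected_simps [simp]:
  "tree_connected E (Leaf v)"
  "tree_connected E (Node l r) \<longleftrightarrow>
     cut_connected E (set (leaves l) \<union> set (leaves r)) \<and> tree_connected E l \<and> tree_connected E r"
  by (auto simp: tree_connected_def)

lemma tree_connectedD: "tree_connected E t \<Longrightarrow> cut_connected E (set (leaves t))"
  by (auto simp: tree_connected_def)

lemma tree_connected_induced:
  "set (leaves t) \<subseteq> G \<Longrightarrow> tree_connected {e \<in> E. e \<subseteq> G} t \<longleftrightarrow> tree_connected E t"
  using leaves_subtrees[of _ t] cut_connected_induced[of _ G E] by (fastforce simp: tree_connected_def)

lemma tree_connected_map:
  "tree_connected E t \<Longrightarrow> tree_connected ((`) f ` E) (map_ptree f t)"
proof (induction t)
  case (Node l r)
  then show ?case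
    using cut_connected_image[of E "set (leaves l) \<union> set (leaves r)" f]
    by (simp add: leaves_map_ptree image_Un)
qed simp

text \<open>Each subtree of \<open>x\<close> becomes a subtree whose leaf set is its preimage under
  the contraction, so \<open>cut_connected_contract\<close> applies node by node; at the leaf
  \<open>s\<close> there is \<open>y\<close>, which is connected by assumption. The equivalence is
  used in both directions: to graft, and to cut a tree apart.\<close>

lemma tree_connected_graft:
  assumes "simple_graph \<Gamma>" "s \<notin> verts \<Gamma> - G" "G = set (leaves y)" "tree_connected (edges \<Gamma>) y"
    and "set (leaves x) \<subseteq> verts (contract \<Gamma> G s)"
  shows "tree_connected (edges (contract \<Gamma> G s)) x \<longleftrightarrow> tree_connected (edges \<Gamma>) (graft s x y)"
  using assms(5)
proof (induction x)
  case (Leaf v)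
  then show ?case using assms(4) by simp
next
  case (Node l r)
  have "cut_connected (edges (contract \<Gamma> G s)) (set (leaves l) \<union> set (leaves r)) \<longleftrightarrow>
      cut_connected (edges \<Gamma>) (set (leaves (graft s l y)) \<union> set (leaves (graft s r y)))"
    using cut_connected_contract[OF assms(1,2), of "set (leaves l) \<union> set (leaves r)"]
      tree_connectedD[OF assms(4)] Node.prems
    by (simp add: leaves_graft set_insert_word assms(3) image_Un)
  then show ?case using Node by simp
qed

lemma admissible_iff:
  assumes "simple_graph \<Gamma>"
  shows "admissible \<Gamma> t \<longleftrightarrow>
    distinct (leaves t) \<and> set (leaves t) = verts \<Gamma> \<and> tree_connected (edges \<Gamma>) t"
  using leaves_subtrees[of _ t] by (auto simp: admissible_def tube_iff[OF assms] tree_connected_def)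

lemma admissible_connected: "\<lbrakk>simple_graph \<Gamma>; admissible \<Gamma> t\<rbrakk> \<Longrightarrow> connected_graph \<Gamma>"
  using tree_connectedD[of "edges \<Gamma>" t] by (simp add: admissible_iff connected_graph_iff)

lemma admissible_induced_iff:
  assumes "simple_graph \<Gamma>" "G \<subseteq> verts \<Gamma>"
  shows "admissible (induced \<Gamma> G) t \<longleftrightarrow>
    distinct (leaves t) \<and> set (leaves t) = G \<and> tree_connected (edges \<Gamma>) t"
  using assms by (auto simp: admissible_iff simple_induced tree_connected_induced)

lemma admissible_graft:
  assumes "connected_graph \<Gamma>" "tube_name \<Gamma> G s"
    and x: "admissible (contract \<Gamma> G s) x" and y: "admissible (induced \<Gamma> G) y"
  shows "admissible \<Gamma> (graft s x y)"
proof -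
  have \<Gamma>: "simple_graph \<Gamma>" "s \<notin> verts \<Gamma> - G" "G \<subseteq> verts \<Gamma>"
    using assms by (auto simp: connected_graph_iff tube_name_def tube_def)
  have y': "distinct (leaves y)" "set (leaves y) = G" "tree_connected (edges \<Gamma>) y"
    using y \<Gamma> by (simp_all add: admissible_induced_iff)
  have x': "distinct (leaves x)" "set (leaves x) = insert s (verts \<Gamma> - G)"
      "tree_connected (edges (contract \<Gamma> G s)) x"
    using x \<Gamma> by (simp_all add: admissible_iff simple_contract)
  have "tree_connected (edges \<Gamma>) (graft s x y)"
    using tree_connected_graft[OF \<Gamma>(1,2) y'(2)[symmetric] y'(3), of x] x' by simp
  moreover have "set (leaves (graft s x y)) = verts \<Gamma>"
    using \<Gamma> x' y' by (auto simp: leaves_graft set_insert_word fibre_def)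
  moreover have "distinct (leaves (graft s x y))"
    using \<Gamma> x' y' by (auto simp: leaves_graft intro!: distinct_insert_word)
  ultimately show ?thesis by (simp add: admissible_iff \<Gamma>)
qed

text \<open>The converse of \<open>admissible_graft\<close>: it recovers the outer factor of an
  admissible tree, which is needed to apply closure of an ideal to a given tree.\<close>

lemma admissible_contract:
  assumes "simple_graph \<Gamma>" "admissible \<Gamma> (graft s x y)" "admissible (induced \<Gamma> G) y" "G \<subseteq> verts \<Gamma>"
    and "distinct (leaves x)" "s \<in> set (leaves x)" "(set (leaves x) - {s}) \<inter> G = {}"
  shows "admissible (contract \<Gamma> G s) x"
proof -
  have y: "set (leaves y) = G" "tree_connected (edges \<Gamma>) y"
    using assms by (simp_all add: admissible_induced_iff)
  have V: "verts \<Gamma> = \<Union> (fibre G s ` set (leaves x))"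
    using assms y by (simp add: admissible_iff leaves_graft set_insert_word)
  then have x: "set (leaves x) = insert s (verts \<Gamma> - G)"
    using assms by (fastforce simp: fibre_def split: if_splits)
  \<comment> \<open>Every fibre other than that of \<open>s\<close> is a singleton different from
    \<open>{s}\<close>, so if \<open>s\<close> is a vertex at all, it lies in
    \<open>G\<close>.\<close>
  have s: "s \<notin> verts \<Gamma> - G"
    using V by (auto simp: fibre_def split: if_splits)
  show ?thesis
    using assms x s tree_connected_graft[OF assms(1) s y(1)[symmetric] y(2), of x]
    by (simp add: admissible_iff simple_contract)
qed

lemma admissible_map:
  assumes "simple_graph \<Gamma>" "inj_on f (verts \<Gamma>)" "admissible \<Gamma> t"
  shows "admissible (map_graph f \<Gamma>) (map_ptree f t)"
  using assms tree_connected_map[of "edges \<Gamma>" t f]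
  by (auto simp: admissible_iff simple_map_graph leaves_map_ptree distinct_map)

lemma simple_path_singleton: "simple_graph (path_graph [v])"
  by (simp add: simple_graph_def path_graph_def)

lemma admissible_path_singleton: "admissible (path_graph [v]) (Leaf v)"
  by (simp add: admissible_iff simple_path_singleton) (simp add: path_graph_def)

section \<open>The contractads of trees and of words\<close>

lemma simple_of_connected: "connected_graph \<Gamma> \<Longrightarrow> simple_graph \<Gamma>"
  by (simp add: connected_graph_def)

lemma admissible_leaves: "admissible \<Gamma> t \<Longrightarrow> set (leaves t) = verts \<Gamma>"
  by (simp add: admissible_def)

lemma tube_nameD: "tube_name \<Gamma> G s \<Longrightarrow> s \<notin> verts \<Gamma> - G \<and> G \<subseteq> verts \<Gamma>"
  by (simp add: tube_name_def tube_def)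

interpretation tree: set_contractad "\<lambda>\<Gamma>. {t. admissible \<Gamma> t}" map_ptree Leaf graft
proof (rule set_contractad.intro, goal_cases)
  case (1 \<Gamma> f x)
  then show ?case by (simp add: admissible_map simple_of_connected)
next
  case (2 \<Gamma> f g x)
  then show ?case
    by (intro ptree.map_cong0) (auto simp: admissible_leaves simp flip: set_leaves)
next
  case (7 \<Gamma> G s x y)
  then show ?case using admissible_graft by simp
next
  case (8 \<Gamma> G s f t x y)
  then show ?case by (intro map_ptree_graft) (auto dest: admissible_leaves)
next
  case (11 \<Gamma> G s H t x y z)
  then show ?case by (intro graft_nested) (auto dest!: admissible_leaves tube_nameD)
next
  case (12 \<Gamma> G s H t x y z)
  then show ?case by (intro graft_disjoint) (auto dest!: admissible_leaves tube_nameD)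
qed (simp_all add: ptree.map_id ptree.map_comp graft_Leaf admissible_path_singleton)

text \<open>Every word here is the leaf word of an admissible tree, and \<open>leaves\<close>
  commutes with relabelling and substitution. Most axioms are thus images of those for
  trees.\<close>

interpretation word: set_contractad "\<lambda>\<Gamma>. leaves ` {t. admissible \<Gamma> t}" map "\<lambda>v. [v]" insert_word
proof (rule set_contractad.intro, goal_cases)
  case (1 \<Gamma> f x)
  then show ?case using tree.m_closed[of \<Gamma> f] by (auto simp flip: leaves_map_ptree)
next
  case (2 \<Gamma> f g x)
  then show ?case by (auto dest: admissible_leaves)
next
  case (5 v)
  show ?case using admissible_path_singleton[of v] by (intro image_eqI[of _ _ "Leaf v"]) auto
next
  case (7 \<Gamma> G s x y)
  then show ?case using admissible_graft[of \<Gamma> G s] by (auto simp flip: leaves_graft)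
next
  case (8 \<Gamma> G s f t x y)
  then show ?case
    using tree.m_c[of \<Gamma> G s f t]
    by (auto simp flip: leaves_graft leaves_map_ptree simp del: fun_upd_apply)
next
  case (10 s x v)
  show ?case by (induction x) auto
next
  case (11 \<Gamma> G s H t x y z)
  then show ?case
    using tree.c_nested[of \<Gamma> G s H t] by (auto simp flip: leaves_graft)
next
  case (12 \<Gamma> G s H t x y z)
  then show ?case
    using tree.c_disjoint[of \<Gamma> G s H t] by (auto simp flip: leaves_graft)
qed simp_all

lemma contractad_BiPlan: "contractad BiPlan"
  unfolding BiPlan_def by (rule tree.contractad_linearization)

lemma contractad_PlanEq: "contractad PlanEq"
  unfolding PlanEq_def by (rule word.contractad_linearization)

lemma BiPlan_simps [simp]:
  "scl BiPlan = free_scale"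
  "carr BiPlan \<Gamma> = free_space {t. admissible \<Gamma> t}"
  "act BiPlan \<Gamma> f = free_map (map_ptree f)"
  "cunit BiPlan v = basis (Leaf v)"
  "icomp BiPlan \<Gamma> G s = free_map2 (graft s)"
  by (simp_all add: BiPlan_def)

lemma PlanEq_simps [simp]:
  "scl PlanEq = free_scale"
  "carr PlanEq \<Gamma> = free_space (leaves ` {t. admissible \<Gamma> t})"
  "act PlanEq \<Gamma> f = free_map (map f)"
  "cunit PlanEq v = basis [v]"
  "icomp PlanEq \<Gamma> G s = free_map2 (insert_word s)"
  by (simp_all add: PlanEq_def)

lemma contractad_morphism_leaf_word: "contractad_morphism BiPlan PlanEq leaf_word"
proof (intro contractad_morphism.intro contractad_BiPlan contractad_PlanEq
    contractad_morphism_axioms.intro, goal_cases)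
  case (1 \<Gamma> x)
  then show ?case
    by (auto simp: leaf_word_def free_map_lin subspace_free_space intro!: lin_closed
        dest: free_space_keys)
qed (simp_all add: leaf_word_def free_map_lin free_map2_lin lin_add lin_scale lin_lin
    leaves_map_ptree leaves_graft)

section \<open>Normal trees\<close>

text \<open>No rotation \<open>(A(BC)) \<mapsto> ((AB)C)\<close> applies to a normal tree.\<close>

fun normal :: "'v set set \<Rightarrow> 'v ptree \<Rightarrow> bool" where
  "normal E (Leaf v) \<longleftrightarrow> True"
| "normal E (Node l r) \<longleftrightarrow> normal E l \<and> normal E r \<and>
     (\<forall>b c. r = Node b c \<longrightarrow> \<not> cut_connected E (set (leaves l) \<union> set (leaves b)))"

lemma normal_induced: "set (leaves t) \<subseteq> G \<Longrightarrow> normal {e \<in> E. e \<subseteq> G} t \<longleftrightarrow> normal E t"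
  by (induction t) (auto simp: cut_connected_induced)

text \<open>Descending in \<open>u\<close> shrinks the straddling tree until its root splits exactly
  at the end of \<open>leaves L\<close>; recursion into \<open>R\<close> moves on to the next
  boundary of the right spine. The condition \<open>q \<noteq> []\<close> keeps \<open>u\<close>
  away from the end of the word: \<open>T\<close> itself is connected and straddles without any
  contradiction.\<close>

lemma normal_no_straddle:
  assumes "T = Node L R" "normal E T" "tree_connected E T" "distinct (leaves T)" "tree_connected E u"
    and "leaves T = p @ leaves u @ q" "q \<noteq> []"
    and "length p < length (leaves L)" "length (leaves L) < length p + length (leaves u)"
  shows False
  using assms
proof (induction T arbitrary: L R u p q)
  case (Leaf v)
  then show ?case by simp
next
  case (Node L' R')
  then have [simp]: "L' = L" "R' = R" by simp_all
  note outer = Node.IH(2)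
  from Node.prems show ?case
  proof (induction u arbitrary: p q)
    case (Leaf v)
    then show ?case by simp
  next
    case (Node u1 u2)
    consider "length (leaves L) < length p + length (leaves u1)"
      | "length (leaves L) > length p + length (leaves u1)"
      | "length (leaves L) = length p + length (leaves u1)"
      by linarith
    then show ?case
    proof cases
      case 1
      then show ?thesis using Node.IH(1)[of p "leaves u2 @ q"] Node.prems by simp
    next
      case 2
      then show ?thesis using Node.IH(2)[of "p @ leaves u1" q] Node.prems by simp
    next
      case 3
      have "leaves L @ leaves R = (p @ leaves u1) @ (leaves u2 @ q)" using Node.prems by simp
      moreover have "length (leaves L) = length (p @ leaves u1)" using 3 by simp
      ultimately have L: "leaves L = p @ leaves u1" and R: "leaves R = leaves u2 @ q"
        using append_eq_append_conv by blast+
      \<comment> \<open>\<open>R\<close> carries the leaves of \<open>u2\<close> and the nonempty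
        word \<open>q\<close>, hence at least two leaves.\<close>
      obtain B C where BC: "R = Node B C"
      proof (cases R)
        case (Leaf v)
        then have "leaves u2 @ q = [v]" using R by simp
        then show ?thesis using Node.prems(7) by (simp add: append_eq_Cons_conv)
      qed
      show ?thesis
      proof (cases "length (leaves B) < length (leaves u2)")
        case True
        \<comment> \<open>Here \<open>u2\<close> reaches beyond \<open>B\<close> and straddles the
          next boundary, now with empty prefix and the same \<open>q\<close>.\<close>
        have "distinct (leaves R)" "normal E R" "tree_connected E R" "tree_connected E u2"
          using Node.prems(2-5) by auto
        then show ?thesis
          using outer[unfolded \<open>R' = R\<close>, OF BC, of u2 "[]" q] R Node.prems(7) True by auto
      next
        case False
        have "leaves u2 = take (length (leaves u2)) (leaves B @ leaves C)"
          using R BC by simp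
        then have "leaves u2 = take (length (leaves u2)) (leaves B)" using False by simp
        then have sub: "set (leaves u2) \<subseteq> set (leaves B)" by (metis set_take_subset)
        have "set (leaves u1) \<inter> set (leaves u2) = {}" using L R Node.prems(4) by auto
        then have "set (leaves u1) \<subset> set (leaves u1) \<union> set (leaves u2)"
          using leaves_not_Nil[of u2] by (cases "leaves u2") auto
        \<comment> \<open>Connectedness of \<open>Node u1 u2\<close> gives an edge between its
          disjoint halves. It joins \<open>L\<close> to \<open>B\<close>, which normality of
          \<open>Node L R\<close> forbids.\<close>
        then obtain x y where xy: "x \<in> set (leaves u1)" "y \<in> set (leaves u2)" "{x, y} \<in> E"
          using cut_connectedD[of E "set (leaves u1) \<union> set (leaves u2)" "set (leaves u1)"]
            Node.prems(5) by auto
        have "cut_connected E (set (leaves L) \<union> set (leaves B))"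
        proof (rule cut_connected_Un[OF _ _ _ _ xy(3)])
          show "cut_connected E (set (leaves L))" "cut_connected E (set (leaves B))"
            using Node.prems(3) BC by (simp_all add: tree_connectedD)
        qed (use xy L sub in auto)
        then show ?thesis using Node.prems(2) BC by simp
      qed
    qed
  qed
qed

text \<open>The left subtrees must have equally many leaves: the longer one would straddle the root
  split of the other tree, with the nonempty word of its own right sibling as \<open>q\<close>.
  Equal lengths split the common word at the same place, and the induction applies to both
  halves.\<close>

lemma normal_unique:
  assumes "normal E t" "normal E t'" "tree_connected E t" "tree_connected E t'"
    and "leaves t = leaves t'" "distinct (leaves t)"
  shows "t = t'"
  using assms
proof (induction t arbitrary: t')
  case (Leaf v)
  then show ?case by (cases t') (auto simp: Cons_eq_append_conv)
next
  case (Node L R)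
  obtain L' R' where t': "t' = Node L' R'"
    using Node.prems(5) by (cases t') (auto simp: append_eq_Cons_conv)
  have dist: "distinct (leaves t')" using Node.prems(5,6) by simp
  have "tree_connected E L" "tree_connected E L'" using Node.prems(3,4) t' by auto
  moreover have "leaves (Node L R) = [] @ leaves L' @ leaves R'" "leaves t' = [] @ leaves L @ leaves R"
    using Node.prems(5) t' by auto
  ultimately have "\<not> length (leaves L) < length (leaves L')" "\<not> length (leaves L') < length (leaves L)"
    using normal_no_straddle[OF refl Node.prems(1,3,6), of L' "[]" "leaves R'"]
      normal_no_straddle[OF t' Node.prems(2,4) dist, of L "[]" "leaves R"] by auto
  then have "length (leaves L) = length (leaves L')" by simp
  then have "leaves L = leaves L'" "leaves R = leaves R'" using Node.prems(5) t' by auto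
  then show ?case using Node.IH(1)[of L'] Node.IH(2)[of R'] Node.prems t' by simp
qed

section \<open>Decomposing admissible trees\<close>

text \<open>Either child can be contracted to a vertex named by one of its own leaves
  \<open>s\<close>, because \<open>Node l r\<close> is the graft of \<open>l\<close> into
  \<open>Node (Leaf s) r\<close>, and symmetrically for \<open>r\<close>.\<close>

lemma admissible_NodeD:
  assumes "simple_graph \<Gamma>" "admissible \<Gamma> (Node l r)"
  shows "admissible (induced \<Gamma> (set (leaves l))) l" "admissible (induced \<Gamma> (set (leaves r))) r"
    "s \<in> set (leaves l) \<Longrightarrow> tube_name \<Gamma> (set (leaves l)) s"
    "s \<in> set (leaves r) \<Longrightarrow> tube_name \<Gamma> (set (leaves r)) s"
    "s \<in> set (leaves l) \<Longrightarrow> admissible (contract \<Gamma> (set (leaves l)) s) (Node (Leaf s) r)"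
    "s \<in> set (leaves r) \<Longrightarrow> admissible (contract \<Gamma> (set (leaves r)) s) (Node l (Leaf s))"
proof -
  have V: "set (leaves l) \<subseteq> verts \<Gamma>" "set (leaves r) \<subseteq> verts \<Gamma>"
    and disj: "set (leaves l) \<inter> set (leaves r) = {}"
    and dist: "distinct (leaves l)" "distinct (leaves r)"
    and conn: "tree_connected (edges \<Gamma>) l" "tree_connected (edges \<Gamma>) r"
    using assms by (auto simp: admissible_iff)
  show l: "admissible (induced \<Gamma> (set (leaves l))) l" and r: "admissible (induced \<Gamma> (set (leaves r))) r"
    using V dist conn assms(1) by (simp_all add: admissible_induced_iff)
  show "tube_name \<Gamma> (set (leaves l)) s" if "s \<in> set (leaves l)"
    using that V conn assms(1) by (auto simp: tube_name_def tube_iff tree_connectedD)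
  show "tube_name \<Gamma> (set (leaves r)) s" if "s \<in> set (leaves r)"
    using that V conn assms(1) by (auto simp: tube_name_def tube_iff tree_connectedD)
  show "admissible (contract \<Gamma> (set (leaves l)) s) (Node (Leaf s) r)" if "s \<in> set (leaves l)"
  proof (rule admissible_contract[OF assms(1) _ l V(1)])
    have "s \<notin> set (leaves r)" using that disj by blast
    then show "admissible \<Gamma> (graft s (Node (Leaf s) r) l)" "distinct (leaves (Node (Leaf s) r))"
      using assms dist by simp_all
  qed (use disj in auto)
  show "admissible (contract \<Gamma> (set (leaves r)) s) (Node l (Leaf s))" if "s \<in> set (leaves r)"
  proof (rule admissible_contract[OF assms(1) _ r V(2)])
    have "s \<notin> set (leaves l)" using that disj by blast
    then show "admissible \<Gamma> (graft s (Node l (Leaf s)) r)" "distinct (leaves (Node l (Leaf s)))"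
      using assms dist by simp_all
  qed (use disj in auto)
qed

section \<open>The ideal generated by the associativity relations\<close>

text \<open>The generated ideal is an intersection, so it suffices to work in an arbitrary ideal
  containing the relations.\<close>

locale assoc_ideal =
  fixes I :: "'v graph \<Rightarrow> ('v ptree \<Rightarrow>\<^sub>0 'k::field) set"
  assumes ideal: "contractad_ideal BiPlan I"
    and relations: "connected_graph \<Gamma> \<Longrightarrow> assoc_relations \<Gamma> \<subseteq> I \<Gamma>"
begin

definition related :: "'v graph \<Rightarrow> 'v ptree \<Rightarrow> 'v ptree \<Rightarrow> bool" where
  "related \<Gamma> t t' \<longleftrightarrow> basis t - basis t' \<in> I \<Gamma>"

lemma subspace: "connected_graph \<Gamma> \<Longrightarrow> free.subspace (I \<Gamma>)"
  using ideal by (simp add: contractad_ideal_def subcollection_def)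

lemma related_refl: "connected_graph \<Gamma> \<Longrightarrow> related \<Gamma> t t"
  using subspace free.subspace_0 by (auto simp: related_def)

lemma related_sym: "\<lbrakk>connected_graph \<Gamma>; related \<Gamma> t t'\<rbrakk> \<Longrightarrow> related \<Gamma> t' t"
  using free.subspace_neg[OF subspace, of \<Gamma> "basis t - basis t'"] by (auto simp: related_def)

lemma related_trans:
  "\<lbrakk>connected_graph \<Gamma>; related \<Gamma> t t'; related \<Gamma> t' t''\<rbrakk> \<Longrightarrow> related \<Gamma> t t''"
  using free.subspace_add[OF subspace, of \<Gamma> "basis t - basis t'" "basis t' - basis t''"]
  by (auto simp: related_def)

lemma icomp_in_ideal:
  "\<lbrakk>connected_graph \<Gamma>; tube_name \<Gamma> G s; x \<in> carr BiPlan (contract \<Gamma> G s); y \<in> carr BiPlan (induced \<Gamma> G);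
     x \<in> I (contract \<Gamma> G s) \<or> y \<in> I (induced \<Gamma> G)\<rbrakk> \<Longrightarrow> icomp BiPlan \<Gamma> G s x y \<in> I \<Gamma>"
  using ideal unfolding contractad_ideal_def by blast

section \<open>Congruence of trees under grafting and rotation\<close>

lemma related_graft_left:
  assumes "connected_graph \<Gamma>" "tube_name \<Gamma> G s" "admissible (contract \<Gamma> G s) x"
    "admissible (contract \<Gamma> G s) x'" "admissible (induced \<Gamma> G) y" "related (contract \<Gamma> G s) x x'"
  shows "related \<Gamma> (graft s x y) (graft s x' y)"
proof -
  have "icomp BiPlan \<Gamma> G s (basis x - basis x') (basis y) \<in> I \<Gamma>"
    using assms by (intro icomp_in_ideal) (auto simp: related_def intro: free.subspace_diff[OF subspace_free_space])
  then show ?thesis by (simp add: related_def free_map2_diff_left free_map2_basis)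
qed

lemma related_graft_right:
  assumes "connected_graph \<Gamma>" "tube_name \<Gamma> G s" "admissible (contract \<Gamma> G s) x"
    "admissible (induced \<Gamma> G) y" "admissible (induced \<Gamma> G) y'" "related (induced \<Gamma> G) y y'"
  shows "related \<Gamma> (graft s x y) (graft s x y')"
proof -
  have "icomp BiPlan \<Gamma> G s (basis x) (basis y - basis y') \<in> I \<Gamma>"
    using assms by (intro icomp_in_ideal) (auto simp: related_def intro: free.subspace_diff[OF subspace_free_space])
  then show ?thesis by (simp add: related_def free_map2_diff_right free_map2_basis)
qed

lemma related_Node:
  assumes \<Gamma>: "simple_graph \<Gamma>" and t: "admissible \<Gamma> (Node l r)"
    and l': "admissible (induced \<Gamma> (set (leaves l))) l'" "related (induced \<Gamma> (set (leaves l))) l l'"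
    and r': "admissible (induced \<Gamma> (set (leaves r))) r'" "related (induced \<Gamma> (set (leaves r))) r r'"
  shows "admissible \<Gamma> (Node l' r') \<and> related \<Gamma> (Node l r) (Node l' r')"
proof -
  let ?s = "hd (leaves l)" and ?s' = "hd (leaves r)"
  have \<Gamma>': "connected_graph \<Gamma>" using admissible_connected[OF \<Gamma> t] .
  have s: "?s \<in> set (leaves l)" "?s' \<in> set (leaves r)" by simp_all
  have disj: "set (leaves l) \<inter> set (leaves r) = {}" using t by (auto simp: admissible_def)
  have ll': "set (leaves l') = set (leaves l)" and rr': "set (leaves r') = set (leaves r)"
    using l' r' by (simp_all add: admissible_def)
  have "?s \<notin> set (leaves r)" "?s' \<notin> set (leaves l')" using s disj ll' by blast+
  then have graft_l: "graft ?s (Node (Leaf ?s) r) u = Node u r"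
    and graft_r: "graft ?s' (Node l' (Leaf ?s')) u = Node l' u" for u
    by simp_all
  \<comment> \<open>The children are exchanged in turn; the intermediate tree must be admissible
    before it can be decomposed at its right child.\<close>
  have A: "admissible \<Gamma> (Node l' r)"
    using admissible_graft[OF \<Gamma>' admissible_NodeD(3,5)[OF \<Gamma> t s(1)] l'(1)] by (simp only: graft_l)
  have "related \<Gamma> (Node l r) (Node l' r)"
    using related_graft_right[OF \<Gamma>' admissible_NodeD(3,5)[OF \<Gamma> t s(1)] admissible_NodeD(1)[OF \<Gamma> t] l']
    by (simp only: graft_l)
  moreover have "related \<Gamma> (Node l' r) (Node l' r')"
    using related_graft_right[OF \<Gamma>' admissible_NodeD(4,6)[OF \<Gamma> A s(2)] admissible_NodeD(2)[OF \<Gamma> A] r']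
    by (simp only: graft_r)
  moreover have "admissible \<Gamma> (Node l' r')"
    using admissible_graft[OF \<Gamma>' admissible_NodeD(4,6)[OF \<Gamma> A s(2)] r'(1)] by (simp only: graft_r)
  ultimately show ?thesis using related_trans[OF \<Gamma>'] by blast
qed

text \<open>Lifts a congruence from the contraction by the leaves of \<open>y\<close> back to
  \<open>\<Gamma>\<close>. The hypothesis \<open>rel\<close> ranges over all graphs admitting both
  trees, so that it can be supplied without describing the contraction.\<close>

lemma related_by_contraction:
  assumes \<Gamma>: "simple_graph \<Gamma>" "admissible \<Gamma> (graft s x y)" "admissible \<Gamma> (graft s x' y)"
    and y: "s \<in> set (leaves y)" "distinct (leaves y)" "tree_connected (edges \<Gamma>) y"
    and x: "distinct (leaves x)" "s \<in> set (leaves x)" "(set (leaves x) - {s}) \<inter> set (leaves y) = {}"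
    and x': "distinct (leaves x')" "s \<in> set (leaves x')" "(set (leaves x') - {s}) \<inter> set (leaves y) = {}"
    and rel: "\<And>\<Delta>. \<lbrakk>simple_graph \<Delta>; admissible \<Delta> x; admissible \<Delta> x'\<rbrakk> \<Longrightarrow> related \<Delta> x x'"
  shows "related \<Gamma> (graft s x y) (graft s x' y)"
proof -
  let ?G = "set (leaves y)"
  have sub: "?G \<subseteq> verts \<Gamma>"
    using \<Gamma>(2) x(2) by (force simp: admissible_def leaves_graft set_insert_word fibre_def)
  then have y': "admissible (induced \<Gamma> ?G) y" using \<Gamma> y by (simp add: admissible_induced_iff)
  have tube: "tube_name \<Gamma> ?G s" using \<Gamma> y sub by (simp add: tube_name_def tube_iff tree_connectedD)
  have "admissible (contract \<Gamma> ?G s) x" "admissible (contract \<Gamma> ?G s) x'"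
    using admissible_contract[OF \<Gamma>(1,2) y' sub x] admissible_contract[OF \<Gamma>(1,3) y' sub x'] .
  moreover have "simple_graph (contract \<Gamma> ?G s)" using \<Gamma> y by (simp add: simple_contract)
  ultimately show ?thesis
    using admissible_connected[OF \<Gamma>(1,2)] tube y' rel by (intro related_graft_left)
qed

lemma related_rotate_leaves:
  assumes "simple_graph \<Gamma>"
    and t: "admissible \<Gamma> (Node (Node (Leaf a) (Leaf b)) (Leaf c))"
      "admissible \<Gamma> (Node (Leaf a) (Node (Leaf b) (Leaf c)))"
  shows "related \<Gamma> (Node (Node (Leaf a) (Leaf b)) (Leaf c)) (Node (Leaf a) (Node (Leaf b) (Leaf c)))"
proof -
  have \<Gamma>: "connected_graph \<Gamma>" using assms admissible_connected by blast
  have abc: "distinct [a, b, c]" "verts \<Gamma> = {a, b, c}" using t by (auto simp: admissible_def)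
  \<comment> \<open>The cut \<open>{x}\<close> of a connected two-element set can only be crossed by
    \<open>{x, y}\<close>. The cherries of the two trees thus yield both edges required in the
    relation.\<close>
  have "{x, y} \<in> edges \<Gamma>" if "cut_connected (edges \<Gamma>) {x, y}" "x \<noteq> y" for x y
    using cut_connectedD[OF that(1), of "{x}"] that(2) by auto
  moreover have "cut_connected (edges \<Gamma>) {a, b}" "cut_connected (edges \<Gamma>) {b, c}"
    using t by (simp_all add: admissible_iff[OF assms(1)] insert_commute)
  ultimately have "{a, b} \<in> edges \<Gamma>" "{b, c} \<in> edges \<Gamma>" using abc by auto
  then have "basis (Node (Node (Leaf a) (Leaf b)) (Leaf c)) - basis (Node (Leaf a) (Node (Leaf b) (Leaf c)))
      \<in> (assoc_relations \<Gamma> :: ('v ptree \<Rightarrow>\<^sub>0 'k) set)"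
    unfolding assoc_relations_def using abc \<Gamma> by (intro free.span_base) blast
  then show ?thesis using relations[OF \<Gamma>] by (auto simp: related_def)
qed

text \<open>Starting from three representative leaves, the subtrees \<open>A\<close>,
  \<open>B\<close> and \<open>C\<close> are inserted one after the other. The intermediate facts are
  stated for all \<open>\<Delta>\<close>, as \<open>related_by_contraction\<close> demands.\<close>

lemma related_rotate:
  assumes "simple_graph \<Gamma>"
    and "admissible \<Gamma> (Node (Node A B) C)" "admissible \<Gamma> (Node A (Node B C))"
  shows "related \<Gamma> (Node (Node A B) C) (Node A (Node B C))"
proof -
  let ?a = "hd (leaves A)" and ?b = "hd (leaves B)" and ?c = "hd (leaves C)"
  have mem: "?a \<in> set (leaves A)" "?b \<in> set (leaves B)" "?c \<in> set (leaves C)" by simp_all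
  have dist: "distinct (leaves A)" "distinct (leaves B)" "distinct (leaves C)"
    and disj: "set (leaves A) \<inter> set (leaves B) = {}" "set (leaves A) \<inter> set (leaves C) = {}"
      "set (leaves B) \<inter> set (leaves C) = {}"
    using assms(2) by (auto simp: admissible_def)
  have notin: "?a \<notin> set (leaves B)" "?a \<notin> set (leaves C)" "?b \<notin> set (leaves A)"
    "?b \<notin> set (leaves C)" "?c \<notin> set (leaves A)" "?c \<notin> set (leaves B)"
    using mem disj by blast+
  then have neq: "?a \<noteq> ?b" "?a \<noteq> ?c" "?b \<noteq> ?c" using mem by metis+
  have A: "related \<Delta> (Node (Node A (Leaf ?b)) (Leaf ?c)) (Node A (Node (Leaf ?b) (Leaf ?c)))"
    if "simple_graph \<Delta>" "admissible \<Delta> (Node (Node A (Leaf ?b)) (Leaf ?c))"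
      "admissible \<Delta> (Node A (Node (Leaf ?b) (Leaf ?c)))" for \<Delta>
    using related_by_contraction[of \<Delta> ?a "Node (Node (Leaf ?a) (Leaf ?b)) (Leaf ?c)" A
        "Node (Leaf ?a) (Node (Leaf ?b) (Leaf ?c))"] that dist neq notin related_rotate_leaves
    by (auto simp: admissible_iff)
  have AB: "related \<Delta> (Node (Node A B) (Leaf ?c)) (Node A (Node B (Leaf ?c)))"
    if "simple_graph \<Delta>" "admissible \<Delta> (Node (Node A B) (Leaf ?c))"
      "admissible \<Delta> (Node A (Node B (Leaf ?c)))" for \<Delta>
    using related_by_contraction[of \<Delta> ?b "Node (Node A (Leaf ?b)) (Leaf ?c)" B
        "Node A (Node (Leaf ?b) (Leaf ?c))"] that dist neq notin disj A
    by (auto simp: admissible_iff)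
  show ?thesis
    using related_by_contraction[of \<Gamma> ?c "Node (Node A B) (Leaf ?c)" C
        "Node A (Node B (Leaf ?c))"] assms dist neq notin disj AB
    by (auto simp: admissible_iff)
qed

text \<open>Both children are normalised first; a rotation at the root may then destroy normality of
  the new left child, so the rotated tree is normalised afresh.\<close>

lemma ex_normal_related:
  assumes "simple_graph \<Gamma>" "admissible \<Gamma> t"
  shows "\<exists>t'. admissible \<Gamma> t' \<and> leaves t' = leaves t \<and> normal (edges \<Gamma>) t' \<and> related \<Gamma> t t'"
  using assms
\<comment> \<open>Lexicographic descent: children have fewer leaves, and a rotation keeps the leaves
  but shortens the right child.\<close>
proof (induction t arbitrary: \<Gamma> rule: wf_induct_rule[OF wf_measures[of
      "[\<lambda>t. length (leaves t), \<lambda>t. case t of Leaf v \<Rightarrow> 0 | Node l r \<Rightarrow> length (leaves r)]"]])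
  case (1 t)
  note \<Gamma> = admissible_connected[OF 1(2,3)]
  show ?case
  proof (cases t)
    case (Leaf v)
    then show ?thesis using 1(3) related_refl[OF \<Gamma>] by auto
  next
    case (Node l r)
    have V: "set (leaves l) \<subseteq> verts \<Gamma>" "set (leaves r) \<subseteq> verts \<Gamma>"
      using 1(3) Node by (auto simp: admissible_def)
    obtain l' where l': "admissible (induced \<Gamma> (set (leaves l))) l'" "leaves l' = leaves l"
      "normal (edges \<Gamma>) l'" "related (induced \<Gamma> (set (leaves l))) l l'"
      using 1(1)[of l "induced \<Gamma> (set (leaves l))"] admissible_NodeD(1)[of \<Gamma> l r] 1(2,3) Node V
      by (auto simp: simple_induced normal_induced)
    obtain r' where r': "admissible (induced \<Gamma> (set (leaves r))) r'" "leaves r' = leaves r"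
      "normal (edges \<Gamma>) r'" "related (induced \<Gamma> (set (leaves r))) r r'"
      using 1(1)[of r "induced \<Gamma> (set (leaves r))"] admissible_NodeD(2)[of \<Gamma> l r] 1(2,3) Node V
      by (auto simp: simple_induced normal_induced)
    have t': "admissible \<Gamma> (Node l' r')" "related \<Gamma> t (Node l' r')"
      using related_Node[of \<Gamma> l r l' r'] 1(2,3) Node l' r' by auto
    show ?thesis
    proof (cases "normal (edges \<Gamma>) (Node l' r')")
      case True
      then show ?thesis using t' l' r' Node by (intro exI[of _ "Node l' r'"]) simp
    next
      case False
      then obtain b c where bc: "r' = Node b c"
        and conn: "cut_connected (edges \<Gamma>) (set (leaves l') \<union> set (leaves b))"
        using l' r' by auto
      let ?u = "Node (Node l' b) c"
      \<comment> \<open>The failure of normality is exactly what makes the new subtree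
        \<open>Node l' b\<close> a tube.\<close>
      have u: "admissible \<Gamma> ?u"
        using t'(1) conn bc by (auto simp: admissible_iff[OF 1(2)] Un_assoc)
      have "leaves ?u = leaves t" using l' r' bc Node by simp
      moreover have "length (leaves c) < length (leaves r)" 
        using r'(2)[symmetric] bc by simp
      ultimately obtain t'' where t'': "admissible \<Gamma> t''" "leaves t'' = leaves t"
        "normal (edges \<Gamma>) t''" "related \<Gamma> ?u t''"
        using 1(1)[of ?u \<Gamma>] 1(2) u Node by auto
      have "related \<Gamma> (Node l' r') ?u"
        using related_sym[OF \<Gamma>] related_rotate[OF 1(2) u] t' bc by simp
      then have "related \<Gamma> t t''" using t' t'' related_trans[OF \<Gamma>] by blast
      then show ?thesis using t'' by blast
    qed
  qed
qed

lemma related_if_same_leaves: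
  assumes "simple_graph \<Gamma>" "admissible \<Gamma> t" "admissible \<Gamma> t'" "leaves t = leaves t'"
  shows "related \<Gamma> t t'"
proof -
  obtain u where u: "admissible \<Gamma> u" "leaves u = leaves t" "normal (edges \<Gamma>) u" "related \<Gamma> t u"
    using ex_normal_related[OF assms(1,2)] by blast
  obtain u' where u': "admissible \<Gamma> u'" "leaves u' = leaves t'" "normal (edges \<Gamma>) u'" "related \<Gamma> t' u'"
    using ex_normal_related[OF assms(1,3)] by blast
  have "u = u'"
    using u u' assms by (intro normal_unique[of "edges \<Gamma>"]) (auto simp: admissible_iff)
  then show ?thesis
    using u u' admissible_connected[OF assms(1,2)] related_sym related_trans by blast
qed

text \<open>Replacing each tree by a chosen tree \<open>nf\<close> with the same word changes
  \<open>x\<close> by an element of the ideal. The result depends linearly on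
  \<open>leaf_word \<Gamma> x\<close>, hence vanishes. The choice is arbitrary; \<open>nf\<close>
  need not be normal.\<close>

lemma kernel_subset:
  assumes "connected_graph \<Gamma>" "x \<in> carr BiPlan \<Gamma>" "leaf_word \<Gamma> x = 0"
  shows "x \<in> I \<Gamma>"
proof -
  define nf where "nf w = (SOME t. admissible \<Gamma> t \<and> leaves t = w)" for w
  have nf: "admissible \<Gamma> (nf (leaves t)) \<and> leaves (nf (leaves t)) = leaves t" if "admissible \<Gamma> t" for t
    unfolding nf_def by (rule someI[of _ t]) (simp add: that)
  have "lin (\<lambda>t. basis t - basis (nf (leaves t))) x \<in> I \<Gamma>"
  proof (rule lin_closed[OF subspace[OF assms(1)]])
    fix t assume "t \<in> Poly_Mapping.keys x"
    then have "admissible \<Gamma> t" using assms(2) by (auto dest: free_space_keys)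
    then show "basis t - basis (nf (leaves t)) \<in> I \<Gamma>"
      using related_if_same_leaves[of \<Gamma> t "nf (leaves t)"] nf simple_of_connected[OF assms(1)]
      by (simp add: related_def)
  qed
  moreover have "lin (\<lambda>t. basis t - basis (nf (leaves t))) x
      = x - lin (\<lambda>w. basis (nf w)) (leaf_word \<Gamma> x)"
    by (simp add: lin_diff_fun lin_basis_id leaf_word_def free_map_lin lin_lin)
  ultimately show ?thesis using assms(3) by simp
qed

end

section \<open>The kernel of the leaf-word morphism\<close>

lemma kernel_ideal: "contractad_ideal BiPlan (\<lambda>\<Gamma>. {x \<in> carr BiPlan \<Gamma>. leaf_word \<Gamma> x = (0 :: 'v list \<Rightarrow>\<^sub>0 'k::field)})"
  (is "contractad_ideal BiPlan ?K")
proof -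
  interpret contractad_morphism "BiPlan :: ('k, 'v, 'v ptree \<Rightarrow>\<^sub>0 'k) contractad_data" PlanEq leaf_word
    by (rule contractad_morphism_leaf_word)
  have "free.subspace (?K \<Gamma>)" for \<Gamma>
    using subspace_free_space[of "{t. admissible \<Gamma> t}"]
    by (auto simp: free.subspace_def leaf_word_def free_map_lin lin_add lin_scale)
  moreover have "act BiPlan \<Gamma> f x \<in> ?K (map_graph f \<Gamma>)"
    if "connected_graph \<Gamma>" "inj_on f (verts \<Gamma>)" "x \<in> ?K \<Gamma>" for \<Gamma> f x
    using that P.act_closed[of \<Gamma> f x] morph_act[of \<Gamma> f x] by (simp add: free_map_lin)
  moreover have "icomp BiPlan \<Gamma> G s x y \<in> ?K \<Gamma>"
    if "connected_graph \<Gamma>" "tube_name \<Gamma> G s" "x \<in> carr BiPlan (contract \<Gamma> G s)"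
      "y \<in> carr BiPlan (induced \<Gamma> G)" "x \<in> ?K (contract \<Gamma> G s) \<or> y \<in> ?K (induced \<Gamma> G)" for \<Gamma> G s x y
    using that P.icomp_closed[of \<Gamma> G s x y] morph_icomp[of \<Gamma> G s x y]
    by (auto simp: free_map2_lin)
  ultimately show ?thesis
    unfolding contractad_ideal_def subcollection_def by auto
qed

lemma relations_subset_kernel:
  assumes "connected_graph \<Gamma>"
  shows "assoc_relations \<Gamma> \<subseteq> {x \<in> carr BiPlan \<Gamma>. leaf_word \<Gamma> x = (0 :: 'v list \<Rightarrow>\<^sub>0 'k::field)}"
  unfolding assoc_relations_def
proof (rule free.span_minimal)
  show "free.subspace {x \<in> carr BiPlan \<Gamma>. leaf_word \<Gamma> x = (0 :: 'v list \<Rightarrow>\<^sub>0 'k)}"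
    using kernel_ideal assms by (auto simp: contractad_ideal_def subcollection_def)
  \<comment> \<open>The edge \<open>{a, b}\<close> makes the cherry of the first tree a tube, and
    \<open>{b, c}\<close> that of the second.\<close>
  have "admissible \<Gamma> (Node (Node (Leaf a) (Leaf b)) (Leaf c)) \<and>
      admissible \<Gamma> (Node (Leaf a) (Node (Leaf b) (Leaf c)))"
    if "distinct [a, b, c]" "verts \<Gamma> = {a, b, c}" "{a, b} \<in> edges \<Gamma>" "{b, c} \<in> edges \<Gamma>" for a b c
  proof -
    have "cut_connected (edges \<Gamma>) ({a} \<union> {b})" "cut_connected (edges \<Gamma>) ({b} \<union> {c})"
      using that by (intro cut_connected_Un; simp)+
    then show ?thesis using that assms by (auto simp: admissible_iff connected_graph_iff insert_commute)
  qed
  then show "{basis (Node (Node (Leaf v1) (Leaf v2)) (Leaf v3)) -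
      basis (Node (Leaf v1) (Node (Leaf v2) (Leaf v3))) | v1 v2 v3.
        connected_graph \<Gamma> \<and> distinct [v1, v2, v3] \<and> verts \<Gamma> = {v1, v2, v3} \<and>
        {v1, v2} \<in> edges \<Gamma> \<and> {v2, v3} \<in> edges \<Gamma>}
      \<subseteq> {x \<in> carr BiPlan \<Gamma>. leaf_word \<Gamma> x = (0 :: 'v list \<Rightarrow>\<^sub>0 'k)}"
    by (auto simp: leaf_word_def free_map_lin lin_diff intro!: free.subspace_diff[OF subspace_free_space])
qed

text \<open>The kernel is one of the ideals being intersected, and \<open>kernel_subset\<close>
  places it inside all of them.\<close>

lemma kernel_eq_ideal_generated:
  assumes "connected_graph \<Gamma>"
  shows "{x \<in> carr BiPlan \<Gamma>. leaf_word \<Gamma> x = (0 :: 'v list \<Rightarrow>\<^sub>0 'k::field)} =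
    ideal_generated BiPlan assoc_relations \<Gamma>"
proof (intro equalityI subsetI)
  fix x assume x: "x \<in> {x \<in> carr BiPlan \<Gamma>. leaf_word \<Gamma> x = (0 :: 'v list \<Rightarrow>\<^sub>0 'k)}"
  have "x \<in> I \<Gamma>" if "contractad_ideal BiPlan I" "\<forall>\<Delta>. connected_graph \<Delta> \<longrightarrow> assoc_relations \<Delta> \<subseteq> I \<Delta>" for I
  proof -
    interpret assoc_ideal I by unfold_locales (use that in auto)
    show ?thesis using kernel_subset assms x by simp
  qed
  then show "x \<in> ideal_generated BiPlan assoc_relations \<Gamma>" by (auto simp: ideal_generated_def)
next
  fix x :: "'v ptree \<Rightarrow>\<^sub>0 'k"
  assume "x \<in> ideal_generated BiPlan assoc_relations \<Gamma>"
  then show "x \<in> {x \<in> carr BiPlan \<Gamma>. leaf_word \<Gamma> x = 0}"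
    unfolding ideal_generated_def using kernel_ideal relations_subset_kernel by blast
qed

section \<open>Surjectivity and generation\<close>

text \<open>A choice of one admissible tree for each word extends to a linear section of
  \<open>leaf_word\<close>.\<close>

lemma leaf_word_image:
  "leaf_word \<Gamma> ` carr BiPlan \<Gamma> = (carr PlanEq \<Gamma> :: ('v list \<Rightarrow>\<^sub>0 'k::field) set)"
proof (intro equalityI subsetI)
  fix y :: "'v list \<Rightarrow>\<^sub>0 'k"
  assume "y \<in> leaf_word \<Gamma> ` carr BiPlan \<Gamma>"
  then show "y \<in> carr PlanEq \<Gamma>"
    by (auto simp: leaf_word_def free_map_lin subspace_free_space intro!: lin_closed dest: free_space_keys)
next
  fix y :: "'v list \<Rightarrow>\<^sub>0 'k"
  assume "y \<in> carr PlanEq \<Gamma>"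
  then have y: "\<exists>t. admissible \<Gamma> t \<and> leaves t = w" if "w \<in> Poly_Mapping.keys y" for w
    using that by (auto dest: free_space_keys)
  define g where "g w = (SOME t. admissible \<Gamma> t \<and> leaves t = w)" for w
  have g: "admissible \<Gamma> (g w) \<and> leaves (g w) = w" if "w \<in> Poly_Mapping.keys y" for w
    unfolding g_def using y[OF that] by (rule someI_ex)
  have "leaf_word \<Gamma> (lin (\<lambda>w. basis (g w)) y) = lin basis y"
    by (simp add: leaf_word_def free_map_lin lin_lin) (rule lin_cong, simp add: g)
  moreover have "lin (\<lambda>w. basis (g w)) y \<in> carr BiPlan \<Gamma>"
    by (auto simp: subspace_free_space g intro!: lin_closed)
  ultimately show "y \<in> leaf_word \<Gamma> ` carr BiPlan \<Gamma>"
    by (metis image_eqI lin_basis_id)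
qed

lemma path_graph_pair: "path_graph [a, b] = \<lparr>verts = {a, b}, edges = {{a, b}}\<rparr>"
  by (auto simp: path_graph_def less_Suc_eq intro!: exI[of _ 0])

lemma admissible_path_pair:
  assumes "a \<noteq> b"
  shows "admissible (path_graph [a, b]) (Node (Leaf a) (Leaf b))"
proof -
  have "simple_graph (path_graph [a, b])"
    using assms by (auto simp: simple_graph_def path_graph_pair)
  moreover have "cut_connected {{a, b}} ({a} \<union> {b})" by (rule cut_connected_Un) auto
  ultimately show ?thesis using assms by (simp add: admissible_iff) (simp add: path_graph_pair)
qed

lemma path_graph_pair_if_admissible:
  assumes "simple_graph \<Gamma>" "admissible \<Gamma> (Node (Leaf a) (Leaf b))"
  shows "\<Gamma> = path_graph [a, b]"
proof -
  have ab: "a \<noteq> b" "verts \<Gamma> = {a, b}" using assms(2) by (auto simp: admissible_def)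
  have "cut_connected (edges \<Gamma>) {a, b}" using assms ab by (simp add: admissible_iff insert_commute)
  then have "{a, b} \<in> edges \<Gamma>" using cut_connectedD[of "edges \<Gamma>" "{a, b}" "{a}"] ab by auto
  moreover have "e = {a, b}" if "e \<in> edges \<Gamma>" for e
    using simple_graphD[OF assms(1) that] ab by auto
  ultimately have "edges \<Gamma> = {{a, b}}" by blast
  then show ?thesis using ab by (cases \<Gamma>) (simp add: path_graph_pair)
qed

lemma path_graph_singleton_if_admissible:
  assumes "simple_graph \<Gamma>" "admissible \<Gamma> (Leaf a)"
  shows "\<Gamma> = path_graph [a]"
proof -
  have "verts \<Gamma> = {a}" using assms(2) by (simp add: admissible_def)
  moreover have "e \<notin> edges \<Gamma>" for e using simple_graphD[OF assms(1), of e] calculation by auto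
  then have "edges \<Gamma> = {}" by blast
  ultimately show ?thesis by (cases \<Gamma>) (simp add: path_graph_def)
qed

text \<open>Contracting both children of the root leaves the path on two vertices, whose word is a
  relabelled generator. Substituting first the word of \<open>r\<close> and then that of
  \<open>l\<close> rebuilds the whole word.\<close>

lemma leaves_in_subcontractad:
  assumes S: "subcontractad PlanEq S"
    and ab: "a \<noteq> b" "basis [a, b] \<in> (S (path_graph [a, b]) :: ('v list \<Rightarrow>\<^sub>0 'k::field) set)"
    and "simple_graph \<Gamma>" "admissible \<Gamma> t"
  shows "basis (leaves t) \<in> S \<Gamma>"
  using assms(4,5)
proof (induction t arbitrary: \<Gamma>)
  case (Leaf v)
  then show ?case using S path_graph_singleton_if_admissible[of \<Gamma> v] by (simp add: subcontractad_def)
next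
  case (Node l r)
  have compose: "free_map2 (insert_word s) x y \<in> S \<Delta>"
    if "connected_graph \<Delta>" "tube_name \<Delta> G s" "x \<in> S (contract \<Delta> G s)" "y \<in> S (induced \<Delta> G)"
    for \<Delta> G s x y
    using S that by (simp add: subcontractad_def)
  have pair: "basis [s, u] \<in> S (path_graph [s, u])" if "s \<noteq> u" for s u
  proof -
    \<comment> \<open>Carries \<open>a\<close> to \<open>s\<close> and \<open>b\<close> to
      \<open>u\<close>; every two-letter word, the reversed generator included, arises in this
      way.\<close>
    let ?f = "\<lambda>v. if v = a then s else u"
    have "connected_graph (path_graph [a, b])"
      using admissible_path_pair[OF ab(1)] ab(1)
      by (intro admissible_connected) (auto simp: simple_graph_def path_graph_pair)
    moreover have "inj_on ?f (verts (path_graph [a, b]))" using that by (auto simp: inj_on_def path_graph_pair)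
    ultimately have "act PlanEq (path_graph [a, b]) ?f (basis [a, b]) \<in> S (map_graph ?f (path_graph [a, b]))"
      using S ab(2) by (simp add: subcontractad_def subcollection_def)
    moreover have "map_graph ?f (path_graph [a, b]) = path_graph [s, u]"
      using ab(1) by (auto simp: path_graph_pair map_graph_def)
    ultimately show ?thesis using ab(1) by (simp add: free_map_lin)
  qed
  let ?s = "hd (leaves l)" and ?u = "hd (leaves r)"
  let ?\<Delta> = "contract \<Gamma> (set (leaves l)) ?s"
  let ?\<Theta> = "contract ?\<Delta> (set (leaves r)) ?u"
  have su: "?s \<in> set (leaves l)" "?u \<in> set (leaves r)" by simp_all
  have disj: "set (leaves l) \<inter> set (leaves r) = {}" using Node.prems by (simp add: admissible_def)
  then have neq: "?s \<noteq> ?u" "?s \<notin> set (leaves r)" using su by (metis disjoint_iff)+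
  have \<Gamma>: "connected_graph \<Gamma>" using admissible_connected[OF Node.prems] .
  note l = admissible_NodeD(1,3,5)[OF Node.prems]
  have \<Delta>: "connected_graph ?\<Delta>" using connected_contract[OF \<Gamma> l(2)[OF su(1)]] .
  note \<Delta>' = simple_of_connected[OF \<Delta>]
  note r = admissible_NodeD(2,4,6)[OF \<Delta>' l(3)[OF su(1)]]
  have \<Theta>: "connected_graph ?\<Theta>" using connected_contract[OF \<Delta> r(2)[OF su(2)]] .
  have "?\<Theta> = path_graph [?s, ?u]"
    using path_graph_pair_if_admissible[OF simple_of_connected[OF \<Theta>] r(3)[OF su(2)]] .
  then have "basis [?s, ?u] \<in> S ?\<Theta>" using pair[OF neq(1)] by simp
  moreover have "basis (leaves r) \<in> S (induced ?\<Delta> (set (leaves r)))"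
    using Node.IH(2) r(1,2) su \<Delta>' by (meson connected_induced_tube simple_of_connected tube_name_def)
  ultimately have "basis (?s # leaves r) \<in> S ?\<Delta>"
    using compose[OF \<Delta> r(2)[OF su(2)], of "basis [?s, ?u]" "basis (leaves r)"] neq
    by (simp add: free_map2_basis)
  moreover have "basis (leaves l) \<in> S (induced \<Gamma> (set (leaves l)))"
    using Node.IH(1) l(1,2) su by (meson connected_induced_tube simple_of_connected tube_name_def)
  \<comment> \<open>The name \<open>?s\<close> occurs only at the front, so the last substitution
    leaves the letters of \<open>r\<close> alone.\<close>
  moreover have "insert_word ?s (leaves r) (leaves l) = leaves r"
    using neq(2) graft_absent leaves_graft by metis
  ultimately show ?case
    using compose[OF \<Gamma> l(2)[OF su(1)], of "basis (?s # leaves r)" "basis (leaves l)"]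
    by (simp add: free_map2_basis)
qed

lemma (in contractad) subcontractad_carr: "subcontractad P (carr P)"
  unfolding subcontractad_def subcollection_def
  using subspace_carr act_closed unit_closed icomp_closed by blast

lemma generated_PlanEq:
  assumes "a \<noteq> b" "connected_graph \<Gamma>"
  shows "subcontractad_generated PlanEq
      (\<lambda>\<Delta>. if \<Delta> = path_graph [a, b] then {basis [a, b], basis [b, a]} else {}) \<Gamma> =
    (carr PlanEq \<Gamma> :: ('v list \<Rightarrow>\<^sub>0 'k::field) set)"
    (is "subcontractad_generated PlanEq ?E \<Gamma> = _")
proof (intro equalityI subsetI)
  fix x assume x: "x \<in> subcontractad_generated PlanEq ?E \<Gamma>"
  \<comment> \<open>Edges are unordered, so both generators live over one and the same
    graph.\<close>
  have "path_graph [b, a] = path_graph [a, b]" by (simp add: path_graph_pair insert_commute)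
  then have "\<exists>t. admissible (path_graph [a, b]) t \<and> leaves t = w" if "w \<in> {[a, b], [b, a]}" for w
    using that admissible_path_pair[of a b] admissible_path_pair[of b a] assms(1)
    by (metis append_Cons append_Nil insertE leaves.simps singletonD)
  then have "?E \<Delta> \<subseteq> carr PlanEq \<Delta>" for \<Delta> by (auto simp: image_iff) metis+
  then show "x \<in> carr PlanEq \<Gamma>"
    using x contractad.subcontractad_carr[OF contractad_PlanEq]
    unfolding subcontractad_generated_def by blast
next
  fix x :: "'v list \<Rightarrow>\<^sub>0 'k"
  assume x: "x \<in> carr PlanEq \<Gamma>"
  have "x \<in> S \<Gamma>" if S: "subcontractad PlanEq S" and E: "\<forall>\<Delta>. connected_graph \<Delta> \<longrightarrow> ?E \<Delta> \<subseteq> S \<Delta>" for S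
  proof -
    have "connected_graph (path_graph [a, b])"
      using admissible_path_pair[OF assms(1)] assms(1)
      by (intro admissible_connected) (auto simp: simple_graph_def path_graph_pair)
    then have "basis [a, b] \<in> S (path_graph [a, b])" using E by auto
    then have "basis w \<in> S \<Gamma>" if "w \<in> Poly_Mapping.keys x" for w
      using that x leaves_in_subcontractad[OF S assms(1)] simple_of_connected[OF assms(2)]
      by (auto dest!: free_space_keys)
    moreover have "free.subspace (S \<Gamma>)"
      using S assms(2) by (simp add: subcontractad_def subcollection_def)
    ultimately have "lin basis x \<in> S \<Gamma>" by (intro lin_closed)
    then show ?thesis by (simp add: lin_basis_id)
  qed
  then show "x \<in> subcontractad_generated PlanEq ?E \<Gamma>" by (auto simp: subcontractad_generated_def)
qed

theorem theorem2p4p3: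
  fixes a b :: "'v::infinite"
  assumes "a \<noteq> b"
  shows "contractad_morphism (BiPlan :: ('k::field, 'v, 'v ptree \<Rightarrow>\<^sub>0 'k) contractad_data) PlanEq leaf_word
    \<and> leaf_word (path_graph [a, b]) (basis (Node (Leaf a) (Leaf b)) :: 'v ptree \<Rightarrow>\<^sub>0 'k) = basis [a, b]
    \<and> (\<forall>\<Gamma> :: 'v graph. connected_graph \<Gamma> \<longrightarrow>
         leaf_word \<Gamma> ` carr BiPlan \<Gamma> = (carr PlanEq \<Gamma> :: ('v list \<Rightarrow>\<^sub>0 'k) set)
       \<and> {x \<in> carr BiPlan \<Gamma>. leaf_word \<Gamma> x = 0} =
           (ideal_generated BiPlan assoc_relations \<Gamma> :: ('v ptree \<Rightarrow>\<^sub>0 'k) set)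
       \<and> subcontractad_generated PlanEq
           (\<lambda>\<Delta>. if \<Delta> = path_graph [a, b] then {basis [a, b], basis [b, a]} else {}) \<Gamma> =
           (carr PlanEq \<Gamma> :: ('v list \<Rightarrow>\<^sub>0 'k) set))"
  by (intro conjI allI impI contractad_morphism_leaf_word leaf_word_image kernel_eq_ideal_generated
      generated_PlanEq assms)
    (simp add: leaf_word_def free_map_lin)

end
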